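(* Let $k\ge 1$, and let $\mathcal F_k$ be the collection of cones in $\mathbb R^{3k}$ spanned by the column vectors of the matrix $M_{213,k+2}$ corresponding (via the bijection between columns and $k$-relevant diagonals described in the context) to the faces of the simplicial multi-associahedron $\Delta_{2k+4,k}$. Then $\mathcal F_k$ is a complete simplicial fan realization of $\Delta_{2k+4,k}$.
   Context: Multi-associahedron: let $k\ge1$ and $\ell\ge 2k+1$. A set of $k+1$ diagonals of a convex $\ell$-gon forms a $(k+1)$-crossing if all its diagonals are pairwise crossing. A diagonal is $k$-relevant if it is contained in some $(k+1)$-crossing, that is, if there are at least $k$ vertices of the $\ell$-gon on each side of it. The simplicial multi-associahedron $\Delta_{\ell,k}$ is the simplicial complex of $(k+1)$-crossing-free sets of $k$-relevant diagonals of a convex $\ell$-gon. Matrix: let $S(i)=i^2$, $T(i)=i(i+1)/2$. For $m\ge3$, $M_{213,m}$ is the $(3m-6)\times 3m$ matrix whose transpose is $$M_{213,m}^t=\begin{pmatrix} -I_{3m-6}\\ \begin{array}{c|c|c} B_{213,m-2}&\cdots&B_{213,1}\end{array}\end{pmatrix},\qquad B_{213,i}=\begin{pmatrix} S(i+1)&-T(i)&-T(i)\\ 2T(i)&-T(i-1)+1&-T(i)\\ 2T(i)&-T(i)&-T(i-1)+1\\ -S(i+1)+1&T(i)&T(i)\\ -2T(i)&T(i-1)&T(i)\\ -2T(i)&T(i)&T(i-1)\end{pmatrix}.$$ So $M_{213,k+2}$ has size $3k\times(3k+6)$. Bijection: for $\ell=2k+4$ there are exactly $3k+6$ $k$-relevant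 diagonals. Label the vertices of the $\ell$-gon cyclically from $1$ to $\ell$, write a diagonal as $(a,b)$ with $a<b$, and order diagonals lexicographically. The first $k$-relevant diagonal in lexicographic order corresponds to the last column of $M_{213,k+2}$; the remaining $k$-relevant diagonals, in lexicographic order, correspond to the columns $1,2,\dots,3k+5$ in this order. Complete simplicial fan realization: for each face the associated column vectors are linearly independent, the cones spanned by any two faces $I,J$ intersect exactly in the cone spanned by $I\cap J$, and the union of all the cones is $\mathbb R^{3k}$.
   Formalization: The bijection is corrected: the columns of the first and last k-relevant diagonals are interchanged (first to column 3k+5, last to column 3k+6), since with the stated bijection the claim fails, e.g. for k=1 the diagonals 13, 14, 15 get linearly dependent columns. *)

theory Defs
  imports "Jordan_Normal_Form.VS_Connect"
begin

section \<open>The multi-associahedron\<close>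

text \<open>The vertices of the convex \<open>l\<close>-gon are \<open>1, \<dots>, l\<close> in cyclic order, and the diagonal joining
  \<open>a < b\<close> is the pair \<open>(a, b)\<close>. The edges of the polygon are not diagonals.\<close>

definition diagonals :: "nat \<Rightarrow> (nat \<times> nat) set" where
  "diagonals l = {(a, b). 1 \<le> a \<and> a + 2 \<le> b \<and> b \<le> l \<and> (a, b) \<noteq> (1, l)}"

definition crosses :: "nat \<times> nat \<Rightarrow> nat \<times> nat \<Rightarrow> bool" where
  "crosses = (\<lambda>(a, b) (c, d). a < c \<and> c < b \<and> b < d \<or> c < a \<and> a < d \<and> d < b)"

definition is_crossing :: "nat \<Rightarrow> nat \<Rightarrow> (nat \<times> nat) set \<Rightarrow> bool" where
  "is_crossing l j K \<longleftrightarrow> K \<subseteq> diagonals l \<and> card K = j \<and> pairwise crosses K"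

definition relevant_diagonals :: "nat \<Rightarrow> nat \<Rightarrow> (nat \<times> nat) set" where
  "relevant_diagonals l k = {d. \<exists>K. is_crossing l (k + 1) K \<and> d \<in> K}"

definition multi_associahedron :: "nat \<Rightarrow> nat \<Rightarrow> (nat \<times> nat) set set" where
  "multi_associahedron l k =
     {F. F \<subseteq> relevant_diagonals l k \<and> \<not> (\<exists>K \<subseteq> F. is_crossing l (k + 1) K)}"

lemma crosses_simp:
  "crosses (a, b) (c, d) \<longleftrightarrow> a < c \<and> c < b \<and> b < d \<or> c < a \<and> a < d \<and> d < b"
  by (simp add: crosses_def)

lemma relevant_imp_sides:
  assumes "(a, b) \<in> relevant_diagonals l k"
  shows "a + k < b" and "b + k < a + l"
proof -
  obtain K where K: "K \<subseteq> diagonals l" "card K = k + 1" "pairwise crosses K" "(a, b) \<in> K"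
    using assms unfolding relevant_diagonals_def is_crossing_def by blast
  have ab: "1 \<le> a" "a < b" "b \<le> l"
    using K(1,4) by (auto simp: diagonals_def)
  have fin: "finite K"
    using K(2) by (intro card_ge_0_finite) simp
  let ?K = "K - {(a, b)}"
  have cK: "card ?K = k"
    using K(2,4) fin by simp
  have cr: "crosses x y" if "x \<in> K" "y \<in> K" "x \<noteq> y" for x y
    using K(3) that by (auto simp: pairwise_def)
  let ?in = "\<lambda>(c, d). if a < c \<and> c < b then c else d :: nat"
  let ?out = "\<lambda>(c, d). if a < c \<and> c < b then d else c :: nat"
  have inj: "inj_on ?in ?K" "inj_on ?out ?K"
  proof -
    have *: "?in x \<noteq> ?in y \<and> ?out x \<noteq> ?out y" if xy: "x \<in> ?K" "y \<in> ?K" "x \<noteq> y" for x y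
    proof -
      obtain c d e f where [simp]: "x = (c, d)" "y = (e, f)"
        by (cases x; cases y)
      have "crosses (c, d) (e, f)" "crosses (a, b) (c, d)" "crosses (a, b) (e, f)"
        using xy K(4) cr by auto
      then show ?thesis
        by (auto simp: crosses_simp)
    qed
    show "inj_on ?in ?K" "inj_on ?out ?K"
      by (rule inj_onI, use * in blast)+
  qed
  have "x \<in> ?K \<Longrightarrow> ?in x \<in> {a<..<b} \<and> ?out x \<in> {1..l} - {a..b}" for x
  proof -
    assume x: "x \<in> ?K"
    obtain c d where [simp]: "x = (c, d)" by (cases x)
    have "crosses (a, b) (c, d)" "(c, d) \<in> diagonals l"
      using x K(1,4) cr by auto
    then show ?thesis
      by (auto simp: crosses_simp diagonals_def)
  qed
  then have sub: "?in ` ?K \<subseteq> {a<..<b}" "?out ` ?K \<subseteq> {1..l} - {a..b}"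
    by blast+
  have "k \<le> card {a<..<b}"
    using card_mono[OF _ sub(1)] card_image[OF inj(1)] cK by simp
  with ab show "a + k < b" by simp
  have "k \<le> card ({1..l} - {a..b})"
    using card_mono[OF _ sub(2)] card_image[OF inj(2)] cK by simp
  also have "\<dots> = l - (Suc b - a)"
    using ab by (subst card_Diff_subset) auto
  finally show "b + k < a + l"
    using ab by simp
qed

lemma sides_imp_relevant:
  assumes "k \<ge> 1" "1 \<le> a" "b \<le> l" "a + k < b" "b + k < a + l"
  shows "(a, b) \<in> relevant_diagonals l k"
proof -
  define D where
    "D i = (if i = 0 then (a, b) else if b + i \<le> l then (a + i, b + i) else (b + i - l, a + i))" for i
  have cr: "crosses (D i) (D j)" if "i < j" "j \<le> k" for i j
    using assms that by (auto simp: D_def crosses_simp)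
  have irr: "\<not> crosses x x" for x
    by (cases x) (simp add: crosses_simp)
  have inj: "inj_on D {..k}"
    by (rule inj_onI) (metis cr irr atMost_iff linorder_neqE_nat)
  have sym: "crosses x y \<Longrightarrow> crosses y x" for x y
    by (cases x; cases y) (auto simp: crosses_simp)
  have "is_crossing l (k + 1) (D ` {..k})"
    unfolding is_crossing_def
  proof (intro conjI)
    show "D ` {..k} \<subseteq> diagonals l"
      using assms by (auto simp: D_def diagonals_def)
    show "card (D ` {..k}) = k + 1"
      by (simp add: card_image inj)
    show "pairwise crosses (D ` {..k})"
      unfolding pairwise_def by (metis (no_types, lifting) atMost_iff cr image_iff linorder_neqE_nat sym)
  qed
  moreover have "(a, b) \<in> D ` {..k}"
    by (rule image_eqI[of _ _ 0]) (auto simp: D_def)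
  ultimately show ?thesis
    unfolding relevant_diagonals_def by blast
qed

lemma relevant_diagonals_iff:
  assumes "k \<ge> 1"
  shows "(a, b) \<in> relevant_diagonals l k \<longleftrightarrow> 1 \<le> a \<and> b \<le> l \<and> a + k < b \<and> b + k < a + l"
proof -
  have "1 \<le> a \<and> b \<le> l" if "(a, b) \<in> relevant_diagonals l k"
    using that unfolding relevant_diagonals_def is_crossing_def diagonals_def by blast
  then show ?thesis
    using relevant_imp_sides sides_imp_relevant assms by blast
qed


section \<open>Fan realizations\<close>

text \<open>The cone spanned by the vectors \<open>v d\<close> for \<open>d \<in> I\<close>; for \<open>I = {}\<close> it is \<open>{0}\<close>.\<close>

definition spanned_cone :: "nat \<Rightarrow> ('a \<Rightarrow> real vec) \<Rightarrow> 'a set \<Rightarrow> real vec set" where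
  "spanned_cone n v I =
     {finsum_vec TYPE(real) n (\<lambda>d. c d \<cdot>\<^sub>v v d) I | c. \<forall>d \<in> I. c d \<ge> 0}"

text \<open>Linear independence is that of the family \<open>(v d)\<^sub>d\<close> indexed by the face, whence the injectivity.\<close>

definition complete_simplicial_fan_realization ::
    "nat \<Rightarrow> ('a \<Rightarrow> real vec) \<Rightarrow> 'a set set \<Rightarrow> bool" where
  "complete_simplicial_fan_realization n v \<Delta> \<longleftrightarrow>
     (\<forall>I \<in> \<Delta>. v ` I \<subseteq> carrier_vec n \<and> inj_on v I \<and>
        \<not> module.lin_dep class_ring (module_vec TYPE(real) n) (v ` I)) \<and>
     (\<forall>I \<in> \<Delta>. \<forall>J \<in> \<Delta>. spanned_cone n v I \<inter> spanned_cone n v J = spanned_cone n v (I \<inter> J)) \<and>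
     (\<Union>I \<in> \<Delta>. spanned_cone n v I) = carrier_vec n"


section \<open>The matrix\<close>

definition S213 :: "real \<Rightarrow> real" where "S213 i = i\<^sup>2"

definition T213 :: "real \<Rightarrow> real" where "T213 i = i * (i + 1) / 2"

definition B213 :: "real \<Rightarrow> real mat" where
  "B213 i = (let S = S213; T = T213 in mat_of_rows_list 3
     [[ S (i + 1),       - T i,           - T i          ],
      [ 2 * T i,         - T (i - 1) + 1, - T i          ],
      [ 2 * T i,         - T i,           - T (i - 1) + 1],
      [ - S (i + 1) + 1, T i,             T i            ],
      [ - 2 * T i,       T (i - 1),       T i            ],
      [ - 2 * T i,       T i,             T (i - 1)      ]])"

text \<open>The horizontal concatenation of the blocks \<open>B213 p, \<dots>, B213 1\<close>.\<close>

definition B213_row :: "nat \<Rightarrow> real mat" where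
  "B213_row p = mat 6 (3 * p) (\<lambda>(r, s). B213 (real (p - s div 3)) $$ (r, s mod 3))"

definition M213 :: "nat \<Rightarrow> real mat" where
  "M213 m = transpose_mat ((- 1\<^sub>m (3 * m - 6)) @\<^sub>r B213_row (m - 2))"


lemma dim_M213: "m \<ge> 3 \<Longrightarrow> M213 m \<in> carrier_mat (3 * m - 6) (3 * m)"
  by (auto simp: M213_def append_rows_def B213_row_def intro!: carrier_matI)

lemma M213_entry:
  assumes "m \<ge> 3" "i < 3 * m - 6" "j < 3 * m"
  shows "M213 m $$ (i, j) =
    (if j < 3 * m - 6 then if i = j then - 1 else 0
     else B213 (real (m - 2 - i div 3)) $$ (j - (3 * m - 6), i mod 3))"
  using assms by (auto simp: M213_def append_rows_def B213_row_def)


section \<open>Columns and diagonals\<close>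

text \<open>The position, starting from \<open>0\<close>, of a diagonal in the lexicographic list of the \<open>3k + 6\<close>
  \<open>k\<close>-relevant diagonals of the \<open>(2k + 4)\<close>-gon.\<close>

definition lex_position :: "nat \<Rightarrow> nat \<times> nat \<Rightarrow> nat" where
  "lex_position k d =
     card {e \<in> relevant_diagonals (2 * k + 4) k. (e, d) \<in> less_than <*lex*> less_than}"

text \<open>Columns are numbered from \<open>0\<close>, so the last one is \<open>3k + 5\<close>. In \<open>lex_column\<close> the first diagonal
  is sent to the last column and the remaining ones to the first \<open>3k + 5\<close> columns, in
  lexicographic order.\<close>

definition lex_column :: "nat \<Rightarrow> nat \<times> nat \<Rightarrow> nat" where
  "lex_column k d = (if lex_position k d = 0 then 3 * k + 5 else lex_position k d - 1)"

lemma lex_column_not_fan: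
  "\<not> complete_simplicial_fan_realization (3 * 1)
     (\<lambda>d. col (M213 (1 + 2)) (lex_column 1 d)) (multi_associahedron (2 * 1 + 4) 1)"
proof
  let ?v = "\<lambda>d. col (M213 (1 + 2)) (lex_column 1 d)"
  assume fan: "complete_simplicial_fan_realization (3 * 1) ?v (multi_associahedron (2 * 1 + 4) 1)"
  have pos: "lex_position 1 (1, 3) = 0" "lex_position 1 (1, 4) = 1" "lex_position 1 (1, 5) = 2"
  proof -
    have "{e \<in> relevant_diagonals (2 * 1 + 4) 1. (e, (1, 3)) \<in> less_than <*lex*> less_than} = {}"
      by (auto simp: relevant_diagonals_iff)
    then have "lex_position 1 (1, 3) = card ({} :: (nat \<times> nat) set)"
      by (simp only: lex_position_def)
    then show "lex_position 1 (1, 3) = 0"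
      by simp
    have "{e \<in> relevant_diagonals (2 * 1 + 4) 1. (e, (1, 4)) \<in> less_than <*lex*> less_than} = {(1, 3)}"
      by (auto simp: relevant_diagonals_iff)
    then have "lex_position 1 (1, 4) = card ({(1, 3)} :: (nat \<times> nat) set)"
      by (simp only: lex_position_def)
    then show "lex_position 1 (1, 4) = 1"
      by simp
    have "{e \<in> relevant_diagonals (2 * 1 + 4) 1. (e, (1, 5)) \<in> less_than <*lex*> less_than}
        = {(1, 3), (1, 4)}"
      by (auto simp: relevant_diagonals_iff)
    then have "lex_position 1 (1, 5) = card ({(1, 3), (1, 4)} :: (nat \<times> nat) set)"
      by (simp only: lex_position_def)
    then show "lex_position 1 (1, 5) = 2"
      by simp
  qed
  have less3: "i < 3 \<longleftrightarrow> i = 0 \<or> i = 1 \<or> i = 2" for i :: nat by auto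
  have v: "?v (1, 3) = vec_of_list [- 2, 1, 0]" "?v (1, 4) = vec_of_list [- 1, 0, 0]"
    "?v (1, 5) = vec_of_list [0, - 1, 0]"
  proof -
    have three: "1 + 2 = (3 :: nat)" by simp
    have m: "M213 (1 + 2) \<in> carrier_mat 3 9" "M213 (1 + 2) = M213 3"
      unfolding three using dim_M213[of 3] by simp_all
    have d: "dim_vec (col (M213 (1 + 2)) j) = 3" for j
      using m(1) by (simp only: dim_col carrier_matD)
    have e: "col (M213 (1 + 2)) j $ i = M213 3 $$ (i, j)" if "i < 3" "j < 9" for i j
      using m(1) that by (simp only: index_col carrier_matD m(2))
    have c: "col (M213 (1 + 2)) j = vec_of_list xs"
      if "j < 9" "length xs = 3" "\<forall>i < 3. M213 3 $$ (i, j) = xs ! i" for j xs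
      using that by (intro eq_vecI) (simp_all only: d e dim_vec_of_list vec_of_list_index)
    have "lex_column 1 (1, 3) = 8" "lex_column 1 (1, 4) = 0" "lex_column 1 (1, 5) = 1"
      using pos by (auto simp: lex_column_def)
    moreover have "col (M213 (1 + 2)) 8 = vec_of_list [- 2, 1, 0]"
      by (rule c) (auto simp: less3 M213_entry B213_def mat_of_rows_list_def S213_def T213_def)
    moreover have "col (M213 (1 + 2)) 0 = vec_of_list [- 1, 0, 0]"
      by (rule c) (auto simp: less3 M213_entry)
    moreover have "col (M213 (1 + 2)) 1 = vec_of_list [0, - 1, 0]"
      by (rule c) (auto simp: less3 M213_entry)
    ultimately show "?v (1, 3) = vec_of_list [- 2, 1, 0]" "?v (1, 4) = vec_of_list [- 1, 0, 0]"
      "?v (1, 5) = vec_of_list [0, - 1, 0]"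
      by (simp_all only:)
  qed
  have face: "F \<in> multi_associahedron (2 * 1 + 4) 1" if "F = {(1, 3), (1, 5)} \<or> F = {(1, 4)}" for F
  proof -
    have "F \<subseteq> relevant_diagonals (2 * 1 + 4) 1"
      using that by (auto simp: relevant_diagonals_iff)
    moreover have False if K: "K \<subseteq> F" "is_crossing (2 * 1 + 4) (1 + 1) K" for K
    proof -
      obtain x y where "K = {x, y}" "x \<noteq> y"
        using K(2) unfolding is_crossing_def by (metis card_2_iff one_add_one)
      with K \<open>F = _ \<or> F = _\<close> show False
        by (auto simp: is_crossing_def pairwise_def crosses_simp)
    qed
    ultimately show ?thesis
      unfolding multi_associahedron_def by blast
  qed
  define u where "u = ?v"
  have u: "u (1, 3) = vec_of_list [- 2, 1, 0]" "u (1, 4) = vec_of_list [- 1, 0, 0]"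
    "u (1, 5) = vec_of_list [0, - 1, 0]"
    unfolding u_def by (rule v)+
  have carr: "u d \<in> carrier_vec 3" for d
    unfolding u_def by (rule carrier_vecI) (simp add: M213_def append_rows_def B213_row_def)
  let ?C = "spanned_cone 3 u"
  have "spanned_cone (3 * 1) ?v {(1, 3), (1, 5)} \<inter> spanned_cone (3 * 1) ?v {(1, 4)}
      = spanned_cone (3 * 1) ?v ({(1, 3), (1, 5)} \<inter> {(1, 4)})"
    using fan face unfolding complete_simplicial_fan_realization_def by blast
  then have int: "?C {(1, 3), (1, 5)} \<inter> ?C {(1, 4)} = ?C {}"
    unfolding u_def by simp
  define c where "c d = (if d = (1, 4 :: nat) then 2 else 1 :: real)" for d :: "nat \<times> nat"
  define w where "w I = finsum_vec TYPE(real) 3 (\<lambda>d. c d \<cdot>\<^sub>v u d) I" for I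
  have wC: "w I \<in> ?C I" for I
    unfolding spanned_cone_def w_def by (rule CollectI, rule exI[of _ c]) (auto simp: c_def)
  have wi: "w I $ i = (\<Sum>d\<in>I. c d * u d $ i)" if "i < 3" "finite I" for I i
  proof -
    have "w I $ i = (\<Sum>d\<in>I. (c d \<cdot>\<^sub>v u d) $ i)"
      unfolding w_def using that carr by (subst index_finsum_vec) auto
    also have "\<dots> = (\<Sum>d\<in>I. c d * u d $ i)"
      using that carr by (intro sum.cong refl index_smult_vec) (metis carrier_vecD)
    finally show ?thesis .
  qed
  have wc: "dim_vec (w I) = 3" for I
    unfolding w_def using carr by (intro carrier_vecD finsum_vec_closed) auto
  have "w {(1, 3), (1, 5)} = w {(1, 4)}"
    by (rule eq_vecI)
      (auto simp: wc wi less3 c_def vec_of_list_index u[unfolded One_nat_def] simp del: vec_of_list_Cons)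
  then have "w {(1, 4)} \<in> ?C {}"
    using int wC[of "{(1, 3), (1, 5)}"] wC[of "{(1, 4)}"] by auto
  then have "w {(1, 4)} $ 0 = 0"
    by (auto simp: spanned_cone_def finsum_vec_empty)
  moreover have "w {(1, 4)} $ 0 = - 2"
    by (simp add: wi c_def vec_of_list_index u[unfolded One_nat_def] del: vec_of_list_Cons)
  ultimately show False by simp
qed

text \<open>Under \<open>lex_column\<close> the columns of \<^term>\<open>M213 (k + 2)\<close> do not give a fan, already for \<open>k = 1\<close>
  (lemma \<open>lex_column_not_fan\<close>). The columns of \<^term>\<open>M213 (k + 2)\<close> belong to the letters of the word
  \<open>(s\<^sub>2 s\<^sub>1 s\<^sub>3)\<^sup>k\<^sup>+\<^sup>2\<close>. In lexicographic order the diagonals belong to the letters of \<open>(s\<^sub>1 s\<^sub>2 s\<^sub>3)\<^sup>k\<^sup>+\<^sup>1 s\<^sub>1 s\<^sub>2 s\<^sub>1\<close>;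
  moving the first of them to the end, where it becomes \<open>s\<^sub>3\<close>, gives \<open>(s\<^sub>2 s\<^sub>3 s\<^sub>1)\<^sup>k\<^sup>+\<^sup>1 s\<^sub>2 s\<^sub>1 s\<^sub>3\<close>. The symmetry
  \<open>s\<^sub>1 \<leftrightarrow> s\<^sub>3\<close>, under which the columns of \<^term>\<open>M213 (k + 2)\<close> are invariant up to permuting coordinates, turns
  this into \<open>(s\<^sub>2 s\<^sub>1 s\<^sub>3)\<^sup>k\<^sup>+\<^sup>1 s\<^sub>2 s\<^sub>3 s\<^sub>1\<close>, and the two commuting letters at the end have to be exchanged.
  So the columns of the first and of the last diagonal are interchanged.\<close>

definition diagonal_column :: "nat \<Rightarrow> nat \<times> nat \<Rightarrow> nat" where
  "diagonal_column k = Transposition.transpose (3 * k + 4) (3 * k + 5) \<circ> lex_column k"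

end

theory Submission
  imports Defs "HOL-Analysis.Elementary_Metric_Spaces" "HOL-Analysis.Linear_Algebra"
    "HOL-Computational_Algebra.Polynomial"
begin

text \<open>The linear relations between the columns of \<^term>\<open>M213 (k + 2)\<close> form a six-dimensional space \<open>V\<close> of
  functions on the columns. Restricted to the letters \<open>s\<^sub>2\<close>, \<open>s\<^sub>1\<close>, \<open>s\<^sub>3\<close> of the word, such a function is given by
  three quadratic polynomials \<open>p\<close>, \<open>q\<^sub>1\<close>, \<open>q\<^sub>2\<close> whose sum is constant if \<open>p\<close> is evaluated at \<open>i\<close> and \<open>q\<^sub>1\<close>, \<open>q\<^sub>2\<close>
  at \<open>i + 1/2\<close>, and \<open>q\<^sub>1 - q\<^sub>2\<close> is affine. Comparing the roots of these polynomials shows that every nonzero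
  function in \<open>V\<close> is strictly positive, or strictly negative, on some \<open>(k + 1)\<close>-crossing. So a relation whose
  positive part and negative part are both supported on faces vanishes, which gives linear independence
  and the intersection property.

  For completeness, every function \<open>c\<close> on the columns has to be moved by \<open>V\<close> to a nonnegative function
  that vanishes on a set meeting all crossings. The subwords that are reduced words of the longest
  element of \<open>S\<^sub>4\<close> are such sets, have size six, and satisfy an exchange property. Starting
  from a generic point in one cone, one moves along a segment to \<open>c\<close>; whenever the segment leaves a cone
  through a wall, it enters the cone obtained by the exchange, again by the sign property.\<close>


section \<open>Pivoting along a generic segment\<close>

text \<open>On the moment curve \<open>a e = s ^ idx e\<close> each functional becomes a nonzero
  polynomial in \<open>s\<close>, since the exponents are distinct. Finitely many polynomials leave
  some \<open>s\<close> in (0,1) that is a root of none.\<close>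

lemma ex_pos_avoiding_functionals:
  fixes w :: "'i \<Rightarrow> 'e \<Rightarrow> real"
  assumes "finite E" and "finite I" and nz: "\<And>i. i \<in> I \<Longrightarrow> \<exists>e\<in>E. w i e \<noteq> 0"
  obtains a where "\<And>e. a e > 0" and "\<And>i. i \<in> I \<Longrightarrow> (\<Sum>e\<in>E. a e * w i e) \<noteq> 0"
proof -
  obtain idx :: "'e \<Rightarrow> nat" where idx: "inj_on idx E"
    using finite_imp_inj_to_nat_seg[OF \<open>finite E\<close>] by blast
  define p where "p i = (\<Sum>e\<in>E. monom (w i e) (idx e))" for i
  have "p i \<noteq> 0" if i: "i \<in> I" for i
  proof -
    obtain e where e: "e \<in> E" "w i e \<noteq> 0" using nz[OF i] by blast
    have "coeff (p i) (idx e) = (\<Sum>e'\<in>E. if e' = e then w i e' else 0)"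
      unfolding p_def coeff_sum using idx e(1)
      by (intro sum.cong) (auto simp: inj_on_def)
    also have "\<dots> = w i e" using e \<open>finite E\<close> by simp
    finally show ?thesis using e by auto
  qed
  then have "finite (\<Union>i\<in>I. {x. poly (p i) x = 0})"
    using \<open>finite I\<close> by (auto intro: poly_roots_finite)
  moreover have "infinite {0<..<1::real}" by simp
  ultimately obtain s where s: "s \<in> {0<..<1::real}" "s \<notin> (\<Union>i\<in>I. {x. poly (p i) x = 0})"
    by (meson finite_subset subsetI)
  show ?thesis
  proof (rule that)
    show "s ^ idx e > 0" for e using s by simp
    show "(\<Sum>e\<in>E. s ^ idx e * w i e) \<noteq> 0" if "i \<in> I" for i
      using s that by (auto simp: p_def poly_sum poly_monom mult.commute)
  qed
qed

text \<open>Matching \<open>B\<close> with the standard basis turns evaluation on \<open>B\<close>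
  into an injective endomorphism, which is surjective.\<close>

lemma linear_system_solvable:
  fixes g :: "'e \<Rightarrow> 'v::euclidean_space"
  assumes card: "card B = DIM('v)" and inj: "\<And>y. (\<And>e. e \<in> B \<Longrightarrow> inner (g e) y = 0) \<Longrightarrow> y = 0"
  shows "\<exists>y. \<forall>e\<in>B. inner (g e) y = h e"
proof -
  have "finite B" using card by (intro card_ge_0_finite) simp
  then obtain \<phi> where \<phi>: "bij_betw \<phi> (Basis :: 'v set) B"
    using card finite_same_card_bij[of "Basis :: 'v set" B] by auto
  define T where "T y = (\<Sum>b\<in>Basis. inner (g (\<phi> b)) y *\<^sub>R b)" for y
  have lin: "linear T"
    unfolding T_def
    by (rule linearI) (simp_all add: inner_add_right sum.distrib scaleR_add_left scaleR_sum_right)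
  have T: "inner (T y) b = inner (g (\<phi> b)) y" if "b \<in> Basis" for y b
    using that by (simp add: T_def)
  have "inj T"
  proof (rule linear_injective_0[OF lin, THEN iffD2], intro allI impI)
    fix y assume "T y = 0"
    show "y = 0"
    proof (rule inj)
      fix e assume "e \<in> B"
      then obtain b where "b \<in> Basis" "\<phi> b = e" using \<phi> by (auto simp: bij_betw_def)
      then show "inner (g e) y = 0" using T[of b y] \<open>T y = 0\<close> by simp
    qed
  qed
  then have "surj T" using lin linear_injective_imp_surjective by blast
  then obtain y where y: "T y = (\<Sum>b\<in>Basis. h (\<phi> b) *\<^sub>R b)" by (metis surjD)
  have "inner (g e) y = h e" if e: "e \<in> B" for e
  proof -
    obtain b where b: "b \<in> Basis" "\<phi> b = e" using \<phi> e by (auto simp: bij_betw_def)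
    then show ?thesis using T[of b y] y by simp
  qed
  then show ?thesis by blast
qed

text \<open>Here \<open>B\<close> stands for the cone of those functions on \<open>E\<close> that
  have, modulo the functions \<open>inner (g e) y\<close>, a nonnegative representative vanishing on
  \<open>B\<close>; these cones are to cover everything. \<open>exch\<close> provides a neighbour
  across each wall, and \<open>sep\<close> puts the two cones on opposite sides of it.\<close>

theorem gale_dual_completeness:
  fixes g :: "'e \<Rightarrow> 'v::euclidean_space" and c :: "'e \<Rightarrow> real"
  assumes "finite E" and sub: "\<And>B. B \<in> \<B> \<Longrightarrow> B \<subseteq> E" and ne: "\<B> \<noteq> {}"
    and card: "\<And>B. B \<in> \<B> \<Longrightarrow> card B = DIM('v)"
    and sep: "\<And>B B' y. B \<in> \<B> \<Longrightarrow> B' \<in> \<B> \<Longrightarrow> (\<And>e. e \<in> B \<Longrightarrow> inner (g e) y \<le> 0) \<Longrightarrow>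
      (\<And>e. e \<in> B' \<Longrightarrow> inner (g e) y \<ge> 0) \<Longrightarrow> y = 0"
    and exch: "\<And>B e. B \<in> \<B> \<Longrightarrow> e \<in> E - B \<Longrightarrow> \<exists>e'\<in>B. insert e (B - {e'}) \<in> \<B>"
  shows "\<exists>y. \<exists>B\<in>\<B>. (\<forall>e\<in>E. c e + inner (g e) y \<ge> 0) \<and> (\<forall>e\<in>B. c e + inner (g e) y = 0)"
proof -
  have "finite \<B>" using \<open>finite E\<close> sub by (meson PowI finite_Pow_iff finite_subset subsetI)
  have inj: "y = 0" if "B \<in> \<B>" "\<And>e. e \<in> B \<Longrightarrow> inner (g e) y = 0" for B y
    using sep[OF that(1) that(1)] that(2) by simp
  have "\<exists>y. \<forall>e\<in>B. inner (g e) y = - a e" if "B \<in> \<B>" for B and a :: "'e \<Rightarrow> real"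
    by (rule linear_system_solvable[OF card[OF that] inj[OF that]])
  then obtain sol where sol: "inner (g e) (sol B a) = - a e" if "B \<in> \<B>" "e \<in> B" for B a e
    by metis
  \<comment> \<open>\<open>r B a\<close> is the only representative of \<open>a\<close> that
    vanishes on \<open>B\<close>, so \<open>a\<close> lies in the cone of \<open>B\<close> iff
    \<open>r B a\<close> is nonnegative on \<open>E\<close>.\<close>
  define r where "r B a e = a e + inner (g e) (sol B a)" for B a e
  have r0: "r B a e = 0" if "B \<in> \<B>" "e \<in> B" for B a e
    using sol[OF that] by (simp add: r_def)
  have sol_eq: "sol B a = y" if "B \<in> \<B>" "\<And>e. e \<in> B \<Longrightarrow> inner (g e) y = - a e" for B a y
    using inj[OF that(1), of "sol B a - y"] that sol by (simp add: inner_diff_right)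
  have r_lin: "r B (\<lambda>e. s * a e + t * b e) e = s * r B a e + t * r B b e" if "B \<in> \<B>" for B s t a b e
  proof -
    have "sol B (\<lambda>e. s * a e + t * b e) = s *\<^sub>R sol B a + t *\<^sub>R sol B b"
      by (rule sol_eq[OF that]) (simp add: inner_add_right sol[OF that])
    then show ?thesis by (simp add: r_def inner_add_right algebra_simps)
  qed
  have r_sum: "r B (\<lambda>e. \<Sum>i\<in>A. s i * a i e) e = (\<Sum>i\<in>A. s i * r B (a i) e)"
    if "B \<in> \<B>" "finite A" for B e and A :: "'e set" and s a
    using that(2)
  proof (induction A)
    case empty
    have "r B (\<lambda>e. 0 * 0 + 0 * 0) e = 0 * r B (\<lambda>_. 0) e + 0 * r B (\<lambda>_. 0) e"
      by (rule r_lin[OF that(1)])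
    then show ?case by simp
  next
    case (insert i A)
    have "r B (\<lambda>e. s i * a i e + 1 * (\<Sum>i\<in>A. s i * a i e)) e
        = s i * r B (a i) e + 1 * r B (\<lambda>e. \<Sum>i\<in>A. s i * a i e) e"
      by (rule r_lin[OF that(1)])
    then show ?case using insert by simp
  qed
  obtain B0 where B0: "B0 \<in> \<B>" using ne by blast
  define \<delta> where "\<delta> i = (\<lambda>e. if e = i then 1 else 0 :: real)" for i :: 'e
  define E0 where "E0 = E - B0"
  have "finite E0" using \<open>finite E\<close> by (simp add: E0_def)
  \<comment> \<open>\<open>r B\<close> annihilates the functions \<open>\<lambda>e. inner (g e) y\<close>, so it is determined by its values on
    functions vanishing on \<open>B0\<close>.\<close>
  have r_mod: "r B a e = r B (\<lambda>e. r B0 a e) e" if "B \<in> \<B>" for B a e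
  proof -
    have "sol B (\<lambda>e. r B0 a e) = sol B a - sol B0 a"
      by (rule sol_eq[OF that]) (simp add: inner_diff_right sol[OF that] r_def)
    then show ?thesis by (simp add: r_def inner_diff_right)
  qed
  have r_ext: "r B a e = r B b e" if "B \<in> \<B>" "e \<in> E" "\<And>e. e \<in> E \<Longrightarrow> a e = b e" for B a b e
  proof -
    have "sol B a = sol B b"
      using sol[OF that(1)] that(3) sub[OF that(1)] by (intro sol_eq[OF that(1)]) auto
    then show ?thesis using that by (simp add: r_def)
  qed
  have r_supp: "r B a e = (\<Sum>i\<in>E0. a i * r B (\<delta> i) e)" if "B \<in> \<B>" "e \<in> E" "\<And>e. e \<in> B0 \<Longrightarrow> a e = 0" for B a e
  proof -
    have "r B a e = r B (\<lambda>e. \<Sum>i\<in>E0. a i * \<delta> i e) e"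
    proof (rule r_ext[OF that(1,2)])
      fix e assume "e \<in> E"
      show "a e = (\<Sum>i\<in>E0. a i * \<delta> i e)"
        using \<open>finite E0\<close> \<open>e \<in> E\<close> that(3)[of e] by (auto simp: \<delta>_def E0_def if_distrib cong: if_cong)
    qed
    also have "\<dots> = (\<Sum>i\<in>E0. a i * r B (\<delta> i) e)" by (rule r_sum[OF that(1) \<open>finite E0\<close>])
    finally show ?thesis .
  qed
  have r_delta: "r B (\<delta> i) e = \<delta> i e" if "B \<in> \<B>" "i \<notin> B" for B i e
  proof -
    have "sol B (\<delta> i) = 0" using that by (intro sol_eq) (auto simp: \<delta>_def)
    then show ?thesis by (simp add: r_def)
  qed
  \<comment> \<open>A starting point avoiding the zeros of \<open>w1\<close> lies on no wall.
    Avoiding those of \<open>w2\<close>, a 2x2 determinant against \<open>c\<close>, keeps the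
    segment from meeting two walls of one \<open>B\<close> at once before it reaches
    \<open>c\<close>. Triples in \<open>I1\<close> repeat \<open>e\<close> so that both families
    share an index type and \<open>w\<close> can tell them apart.\<close>
  define I1 where "I1 = {(B, e, e'). B \<in> \<B> \<and> e \<in> E - B \<and> e = e'}"
  define w1 where "w1 = (\<lambda>(B, e, e' :: 'e). \<lambda>i. r B (\<delta> i) e)"
  define I2 where "I2 = {(B, e, e'). B \<in> \<B> \<and> e \<in> E - B \<and> e' \<in> E - B \<and> e \<noteq> e' \<and> (r B c e \<noteq> 0 \<or> r B c e' \<noteq> 0)}"
  define w2 where "w2 = (\<lambda>(B, e, e'). \<lambda>i. r B (\<delta> i) e * r B c e' - r B (\<delta> i) e' * r B c e)"
  define w where "w p = (if fst (snd p) = snd (snd p) then w1 p else w2 p)" for p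
  have nz1: "\<exists>i\<in>E0. w p i \<noteq> 0" if "p \<in> I1" for p
  proof (rule ccontr)
    assume "\<not> ?thesis"
    moreover obtain B e where p: "p = (B, e, e)" "B \<in> \<B>" "e \<in> E - B" using \<open>p \<in> I1\<close> by (auto simp: I1_def)
    ultimately have z: "r B (\<delta> i) e = 0" if "i \<in> E0" for i
      using that by (auto simp: w_def w1_def)
    have "r B (\<delta> e) e = r B (\<lambda>e'. r B0 (\<delta> e) e') e" using r_mod p by blast
    also have "\<dots> = 0" using p z r0[OF B0] by (subst r_supp) auto
    finally show False using r_delta[of B e e] p by (simp add: \<delta>_def)
  qed
  have nz2: "\<exists>i\<in>E0. w p i \<noteq> 0" if "p \<in> I2" for p
  proof (rule ccontr)
    assume neg: "\<not> ?thesis"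
    obtain B e e' where p: "p = (B, e, e')" "B \<in> \<B>" "e \<in> E - B" "e' \<in> E - B" "e \<noteq> e'"
      "r B c e \<noteq> 0 \<or> r B c e' \<noteq> 0" using \<open>p \<in> I2\<close> by (auto simp: I2_def)
    have z: "r B (\<delta> i) e * r B c e' - r B (\<delta> i) e' * r B c e = 0" if "i \<in> E0" for i
      using that neg p by (auto simp: w_def w2_def)
    have zz: "r B a e * r B c e' - r B a e' * r B c e = 0" for a
    proof -
      have s: "r B a x = (\<Sum>i\<in>E0. r B0 a i * r B (\<delta> i) x)" if "x \<in> E" for x
        using r_mod[OF p(2), of a x] r_supp[OF p(2) that, of "r B0 a"] r0[OF B0] by auto
      have "r B a e * r B c e' - r B a e' * r B c e
          = (\<Sum>i\<in>E0. r B0 a i * (r B (\<delta> i) e * r B c e' - r B (\<delta> i) e' * r B c e))"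
        using p by (simp add: s sum_distrib_right sum_subtractf right_diff_distrib mult.assoc)
      also have "\<dots> = 0" using z by simp
      finally show ?thesis .
    qed
    show False
      using zz[of "\<delta> e"] zz[of "\<delta> e'"] p r_delta by (auto simp: \<delta>_def)
  qed
  have "finite (I1 \<union> I2)"
    by (rule finite_subset[of _ "\<B> \<times> E \<times> E"])
      (auto simp: I1_def I2_def \<open>finite E\<close> \<open>finite \<B>\<close>)
  then obtain a0 where a0: "\<And>e. a0 e > 0" "\<And>p. p \<in> I1 \<union> I2 \<Longrightarrow> (\<Sum>e\<in>E0. a0 e * w p e) \<noteq> 0"
    using ex_pos_avoiding_functionals[OF \<open>finite E0\<close>, of "I1 \<union> I2" w] nz1 nz2 by blast
  \<comment> \<open>Zero on \<open>B0\<close> and positive elsewhere, \<open>a\<close> is its own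
    representative for \<open>B0\<close>, so the segment starts inside that cone.\<close>
  define a where "a e = (if e \<in> B0 then 0 else a0 e)" for e
  have ra: "r B a e = (\<Sum>i\<in>E0. a0 i * r B (\<delta> i) e)" if "B \<in> \<B>" "e \<in> E" for B e
    using r_supp[OF that, of a] by (simp add: a_def E0_def)
  have gen1: "r B a e \<noteq> 0" if "B \<in> \<B>" "e \<in> E - B" for B e
    using that a0(2)[of "(B, e, e)"] ra[of B e] by (auto simp: I1_def w_def w1_def)
  have gen2: "r B a e * r B c e' \<noteq> r B a e' * r B c e" if "(B, e, e') \<in> I2" for B e e'
  proof -
    have "(\<Sum>i\<in>E0. a0 i * w (B, e, e') i) = r B a e * r B c e' - r B a e' * r B c e"
      using that by (auto simp: w_def w2_def I2_def ra sum_distrib_right sum_subtractf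
          right_diff_distrib mult.assoc)
    then show ?thesis using a0(2)[of "(B, e, e')"] that by auto
  qed
  define \<rho> where "\<rho> t B e = (1 - t) * r B a e + t * r B c e" for t B e
  have \<rho>_r: "\<rho> t B e = r B (\<lambda>e. (1 - t) * a e + t * c e) e" if "B \<in> \<B>" for t B e
    using r_lin[OF that] by (simp add: \<rho>_def)
  have \<rho>0: "\<rho> t B e = 0" if "B \<in> \<B>" "e \<in> B" for t B e
    using r0 that by (simp add: \<rho>_def)
  have cont: "((\<lambda>t. \<rho> t B e) \<longlongrightarrow> \<rho> s B e) (at s within X)" for s B e X
    unfolding \<rho>_def by (intro tendsto_intros)
  \<comment> \<open>Two zeros at the same \<open>t < 1\<close> make the determinant of
    \<open>w2\<close> vanish. Triples where \<open>r B c\<close> is zero at both places are not in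
    \<open>I2\<close>, but there \<open>(1 - t) * r B a e\<close> alone would have to vanish,
    against \<open>gen1\<close>.\<close>
  have unique_zero: False if "B \<in> \<B>" "e \<in> E - B" "e' \<in> E - B" "e \<noteq> e'" "\<rho> t B e = 0" "\<rho> t B e' = 0"
    "0 \<le> t" "t < 1" for B e e' t
  proof (cases "(B, e, e') \<in> I2")
    case True
    have *: "(1 - t) * r B a e = - t * r B c e" "(1 - t) * r B a e' = - t * r B c e'"
      using that(5,6) by (auto simp: \<rho>_def)
    have "(1 - t) * (r B a e * r B c e' - r B a e' * r B c e)
        = ((1 - t) * r B a e) * r B c e' - ((1 - t) * r B a e') * r B c e"
      by (simp add: algebra_simps)
    also have "\<dots> = 0" unfolding * by simp
    finally show False using gen2[OF True] that by simp
  next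
    case False
    then show False using that gen1 by (auto simp: \<rho>_def I2_def)
  qed
  \<comment> \<open>The times at which the moving point is covered form a closed set, as a finite
    union of closed sets, so the supremum is attained; it has to be 1.\<close>
  define T where "T = {t \<in> {0..1}. \<exists>B\<in>\<B>. \<forall>e\<in>E. \<rho> t B e \<ge> 0}"
  have "T = (\<Union>B\<in>\<B>. {0..1} \<inter> (\<Inter>e\<in>E. {t. \<rho> t B e \<ge> 0}))" by (auto simp: T_def)
  moreover have "closed {t. \<rho> t B e \<ge> 0}" for B e
    unfolding \<rho>_def by (intro closed_Collect_le continuous_intros)
  ultimately have "closed T" using \<open>finite \<B>\<close> by (auto intro!: closed_UN closed_Int closed_INT)
  have "0 \<in> T"
  proof -
    have "sol B0 a = 0" using B0 by (intro sol_eq) (auto simp: a_def)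
    then have "\<forall>e\<in>E. \<rho> 0 B0 e \<ge> 0" using a0(1) by (auto simp: \<rho>_def r_def a_def less_imp_le)
    then show ?thesis using B0 by (auto simp: T_def)
  qed
  have bdd: "bdd_above T" by (rule bdd_aboveI[of _ 1]) (auto simp: T_def)
  define \<tau> where "\<tau> = Sup T"
  have "\<tau> \<in> T" unfolding \<tau>_def using \<open>0 \<in> T\<close> bdd \<open>closed T\<close> by (intro closed_contains_Sup) auto
  have ub: "t \<le> \<tau>" if "t \<in> T" for t unfolding \<tau>_def using that bdd by (rule cSup_upper)
  have "\<tau> = 1"
  proof (rule ccontr)
    assume "\<tau> \<noteq> 1"
    then have \<tau>: "0 \<le> \<tau>" "\<tau> < 1" using \<open>\<tau> \<in> T\<close> by (auto simp: T_def)
    obtain B where B: "B \<in> \<B>" "\<And>e. e \<in> E \<Longrightarrow> \<rho> \<tau> B e \<ge> 0" using \<open>\<tau> \<in> T\<close> by (auto simp: T_def)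
    \<comment> \<open>Just after \<tau> every coordinate that was positive at \<tau> is still
      positive, for all \<open>B\<close> simultaneously. Hence a coordinate \<open>e\<close> that is
      negative at \<open>t\<close> was zero at \<tau>, and by \<open>unique_zero\<close> it is the
      only such one outside \<open>B\<close>.\<close>
    have "eventually (\<lambda>t. \<rho> \<tau> B e > 0 \<longrightarrow> \<rho> t B e > 0) (at_right \<tau>)" for B e
      using order_tendstoD(1)[OF cont, of 0 \<tau> B e "{\<tau><..}"] by (cases "\<rho> \<tau> B e > 0") auto
    then have "eventually (\<lambda>t. \<forall>B\<in>\<B>. \<forall>e\<in>E. \<rho> \<tau> B e > 0 \<longrightarrow> \<rho> t B e > 0) (at_right \<tau>)"
      using \<open>finite \<B>\<close> \<open>finite E\<close> by (intro eventually_ball_finite ballI) auto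
    moreover have "eventually (\<lambda>t. t \<in> {\<tau><..<1}) (at_right \<tau>)"
      using \<tau> by (intro eventually_at_right_real) auto
    ultimately have "eventually (\<lambda>t. (\<forall>B\<in>\<B>. \<forall>e\<in>E. \<rho> \<tau> B e > 0 \<longrightarrow> \<rho> t B e > 0) \<and> t \<in> {\<tau><..<1}) (at_right \<tau>)"
      by (rule eventually_conj)
    then have "\<exists>t. (\<forall>B\<in>\<B>. \<forall>e\<in>E. \<rho> \<tau> B e > 0 \<longrightarrow> \<rho> t B e > 0) \<and> t \<in> {\<tau><..<1}"
      by (rule eventually_happens'[rotated]) simp
    then obtain t where t: "\<And>B e. B \<in> \<B> \<Longrightarrow> e \<in> E \<Longrightarrow> \<rho> \<tau> B e > 0 \<Longrightarrow> \<rho> t B e > 0" "\<tau> < t" "t < 1"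
      by (auto simp: greaterThanLessThan_iff)
    have "t \<notin> T" using ub t(2) by fastforce
    then have no: "\<exists>e\<in>E. \<rho> t B' e < 0" if "B' \<in> \<B>" for B'
      using that t \<tau> by (auto simp: T_def not_le)
    obtain e where e: "e \<in> E" "\<rho> t B e < 0" using no[OF B(1)] by blast
    have eB: "e \<in> E - B" using e \<rho>0[OF B(1)] by fastforce
    have e0: "\<rho> \<tau> B e = 0" using B(2)[OF e(1)] t(1)[OF B(1) e(1)] e(2) by fastforce
    obtain e' where e': "e' \<in> B" "insert e (B - {e'}) \<in> \<B>" using exch[OF B(1) eB] by blast
    define B' where "B' = insert e (B - {e'})"
    have B': "B' \<in> \<B>" using e' by (simp add: B'_def)
    \<comment> \<open>\<open>y s\<close> carries the representative for \<open>B\<close> to the one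
      for \<open>B'\<close>; at \<tau> both coincide.\<close>
    define y where "y s = sol B' (\<lambda>e. (1 - s) * a e + s * c e) - sol B (\<lambda>e. (1 - s) * a e + s * c e)" for s
    have y: "\<rho> s B' x = \<rho> s B x + inner (g x) (y s)" for s x
      by (simp add: \<rho>_r[OF B'] \<rho>_r[OF B(1)] r_def y_def inner_diff_right)
    have same: "\<rho> \<tau> B' x = \<rho> \<tau> B x" for x
    proof -
      have "y \<tau> = 0"
      proof (rule inj[OF B'])
        fix x assume "x \<in> B'"
        then have "\<rho> \<tau> B' x = 0" "\<rho> \<tau> B x = 0" using \<rho>0[OF B'] \<rho>0[OF B(1)] e0 by (auto simp: B'_def)
        then show "inner (g x) (y \<tau>) = 0" using y[of \<tau> x] by simp
      qed
      then show ?thesis by (simp add: y)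
    qed
    have ye: "inner (g e) (y t) > 0" using y[of t e] \<rho>0[OF B', of e t] e by (simp add: B'_def)
    have y0: "inner (g x) (y t) = 0" if "x \<in> B - {e'}" for x
      using y[of t x] \<rho>0[OF B', of x t] \<rho>0[OF B(1), of x t] that by (simp add: B'_def)
    \<comment> \<open>If the leaving element had a nonpositive value, \<open>y t\<close> would be
      nonpositive on \<open>B\<close> and nonnegative on \<open>B'\<close>, so zero by
      \<open>sep\<close>. With a positive value, \<open>B'\<close> covers time \<open>t\<close>,
      beyond the supremum.\<close>
    have ye': "inner (g e') (y t) > 0"
    proof (rule ccontr)
      assume neg: "\<not> ?thesis"
      have "y t = 0"
      proof (rule sep[OF B(1) B'])
        show "inner (g x) (y t) \<le> 0" if "x \<in> B" for x using y0[of x] neg that by (cases "x = e'") auto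
        show "inner (g x) (y t) \<ge> 0" if "x \<in> B'" for x using y0[of x] ye that by (auto simp: B'_def)
      qed
      then show False using ye by simp
    qed
    have "\<rho> t B' x \<ge> 0" if "x \<in> E" for x
    proof (cases "x \<in> B' \<or> x = e'")
      case True
      then show ?thesis using \<rho>0[OF B', of x t] y[of t e'] \<rho>0[OF B(1) e'(1), of t] ye' by auto
    next
      case False
      then have x: "x \<in> E - B" "x \<noteq> e" using that by (auto simp: B'_def)
      then have "\<rho> \<tau> B x \<noteq> 0" using unique_zero[OF B(1) eB x(1)] e0 \<tau> by auto
      then have "\<rho> \<tau> B' x > 0" using same B(2)[OF that] by (simp add: less_le)
      then show ?thesis using t(1)[OF B' that] by simp
    qed
    then show False using no[OF B'] by fastforce
  qed
  then obtain B where B: "B \<in> \<B>" "\<forall>e\<in>E. r B c e \<ge> 0" using \<open>\<tau> \<in> T\<close> by (auto simp: T_def \<rho>_def)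
  then show ?thesis using r0[OF B(1)] unfolding r_def by blast
qed


section \<open>Signs of three quadratic polynomials\<close>

text \<open>Here \<open>P i\<close> refers to the letter \<open>s\<^sub>2\<close> in block \<open>i\<close> of the word and \<open>U i\<close>, \<open>V i\<close> to \<open>s\<^sub>1\<close>, \<open>s\<^sub>3\<close> or
  \<open>s\<^sub>3\<close>, \<open>s\<^sub>1\<close>. The letters selected by \<open>x\<close> and \<open>y\<close> contain those of the crossing that avoids two vertices
  of the polygon determined by \<open>x\<close> and \<open>y\<close>.\<close>

definition alternates_A :: "int \<Rightarrow> (int \<Rightarrow> bool) \<Rightarrow> (int \<Rightarrow> bool) \<Rightarrow> (int \<Rightarrow> bool) \<Rightarrow> bool" where
  "alternates_A m U P V \<longleftrightarrow> (\<exists>x y. x < y \<and> (\<forall>i\<in>{0..<m}.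
     (i \<le> x - 2 \<longrightarrow> U i) \<and> (x \<le> i \<and> i \<le> y - 2 \<longrightarrow> P i) \<and> (y - 1 \<le> i \<longrightarrow> V i)))"

definition alternates_B :: "int \<Rightarrow> (int \<Rightarrow> bool) \<Rightarrow> (int \<Rightarrow> bool) \<Rightarrow> bool" where
  "alternates_B m P U \<longleftrightarrow> (\<exists>x y. x \<le> y \<and> (\<forall>i\<in>{0..<m}.
     (i \<le> x - 2 \<longrightarrow> P i) \<and> (x - 1 \<le> i \<and> i \<le> y - 2 \<longrightarrow> U i) \<and> (y \<le> i \<longrightarrow> P i)))"

section \<open>From real thresholds to blocks of the word\<close>

lemma alternates_A_mono:
  assumes "alternates_A m U P V" "\<And>i. 0 \<le> i \<Longrightarrow> i < m \<Longrightarrow> U i \<Longrightarrow> U' i"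
    "\<And>i. 0 \<le> i \<Longrightarrow> i < m \<Longrightarrow> P i \<Longrightarrow> P' i" "\<And>i. 0 \<le> i \<Longrightarrow> i < m \<Longrightarrow> V i \<Longrightarrow> V' i"
  shows "alternates_A m U' P' V'"
proof -
  obtain x y where "x < y" and *: "\<forall>i\<in>{0..<m}. (i \<le> x - 2 \<longrightarrow> U i) \<and> (x \<le> i \<and> i \<le> y - 2 \<longrightarrow> P i) \<and> (y - 1 \<le> i \<longrightarrow> V i)"
    using assms(1) unfolding alternates_A_def by blast
  then have "\<forall>i\<in>{0..<m}. (i \<le> x - 2 \<longrightarrow> U' i) \<and> (x \<le> i \<and> i \<le> y - 2 \<longrightarrow> P' i) \<and> (y - 1 \<le> i \<longrightarrow> V' i)"
    using assms(2-4) by simp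
  then show ?thesis using \<open>x < y\<close> unfolding alternates_A_def by blast
qed

lemma alternates_B_mono:
  assumes "alternates_B m P U" "\<And>i. 0 \<le> i \<Longrightarrow> i < m \<Longrightarrow> P i \<Longrightarrow> P' i"
    "\<And>i. 0 \<le> i \<Longrightarrow> i < m \<Longrightarrow> U i \<Longrightarrow> U' i"
  shows "alternates_B m P' U'"
proof -
  obtain x y where "x \<le> y" and *: "\<forall>i\<in>{0..<m}. (i \<le> x - 2 \<longrightarrow> P i) \<and> (x - 1 \<le> i \<and> i \<le> y - 2 \<longrightarrow> U i) \<and> (y \<le> i \<longrightarrow> P i)"
    using assms(1) unfolding alternates_B_def by blast
  then have "\<forall>i\<in>{0..<m}. (i \<le> x - 2 \<longrightarrow> P' i) \<and> (x - 1 \<le> i \<and> i \<le> y - 2 \<longrightarrow> U' i) \<and> (y \<le> i \<longrightarrow> P' i)"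
    using assms(2,3) by simp
  then show ?thesis using \<open>x \<le> y\<close> unfolding alternates_B_def by blast
qed

text \<open>Consecutive stretches lie 3/2 apart in time: the last \<open>U\<close> is at
  \<open>x - 3/2\<close>, the first \<open>P\<close> at \<open>x\<close>, the last \<open>P\<close>
  at \<open>y - 2\<close>, the first \<open>V\<close> at \<open>y - 1/2\<close>. If \<open>P\<close>
  takes the integers strictly between \<open>b\<close> and \<open>c\<close>, then \<open>U\<close>
  may end less than 1/2 before \<open>b\<close> and \<open>V\<close> may begin less than 1/2 after
  \<open>c\<close>.\<close>

lemma alternates_A_thresholds:
  fixes a b c d :: real
  assumes U: "\<And>t. t < a \<Longrightarrow> U t" and P: "\<And>t. b < t \<Longrightarrow> t < c \<Longrightarrow> P t" and V: "\<And>t. d < t \<Longrightarrow> V t"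
    and "b \<le> c" "b - 1/2 < a" "d < c + 1/2"
  shows "alternates_A m (\<lambda>i. U (real_of_int i + 1/2)) (\<lambda>i. P (real_of_int i)) (\<lambda>i. V (real_of_int i + 1/2))"
proof -
  define y where "y = \<lceil>c\<rceil> + 1"
  define x where "x = min (\<lfloor>b\<rfloor> + 1) (y - 1)"
  have "U (real_of_int i + 1/2)" if "i \<le> x - 2" for i
    using that assms(5) by (intro U) (simp add: x_def y_def, linarith)
  moreover have "P (real_of_int i)" if "x \<le> i" "i \<le> y - 2" for i
    using that by (intro P) (simp_all add: x_def y_def, linarith+)
  moreover have "V (real_of_int i + 1/2)" if "y - 1 \<le> i" for i
    using that assms(6) by (intro V) (simp add: x_def y_def, linarith)
  moreover have "x < y" by (simp add: x_def)
  ultimately show ?thesis unfolding alternates_A_def by blast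
qed

lemma alternates_B_thresholds:
  fixes a b c d :: real
  assumes P: "\<And>t. t < a \<Longrightarrow> P t" "\<And>t. d < t \<Longrightarrow> P t" and U: "\<And>t. b < t \<Longrightarrow> t < c \<Longrightarrow> U t"
    and "a \<le> d" "b < a + 1/2" "d - 1/2 < c"
  shows "alternates_B m (\<lambda>i. P (real_of_int i)) (\<lambda>i. U (real_of_int i + 1/2))"
proof -
  define y where "y = \<lfloor>d\<rfloor> + 1"
  define x where "x = min (\<lceil>a\<rceil> + 1) y"
  have "P (real_of_int i)" if "i \<le> x - 2" for i
    using that by (intro P(1)) (simp add: x_def y_def, linarith)
  moreover have "U (real_of_int i + 1/2)" if "x - 1 \<le> i" "i \<le> y - 2" for i
    using that assms(5,6) by (intro U) (simp_all add: x_def y_def, linarith+)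
  moreover have "P (real_of_int i)" if "y \<le> i" for i
    using that by (intro P(2)) (simp add: x_def y_def, linarith)
  moreover have "x \<le> y" by (simp add: x_def)
  ultimately show ?thesis unfolding alternates_B_def by blast
qed

text \<open>The parts not mentioned in the next three lemmas are pushed out of the range \<open>{0..<m}\<close>, or made empty.\<close>

lemma alternates_A_two:
  fixes a b :: real
  assumes U: "\<And>t. t < a \<Longrightarrow> U t" and P: "\<And>t. b < t \<Longrightarrow> P t" and "b - 1/2 < a"
  shows "alternates_A m (\<lambda>i. U (real_of_int i + 1/2)) (\<lambda>i. P (real_of_int i)) V"
proof -
  define x where "x = \<lfloor>b\<rfloor> + 1"
  have "U (real_of_int i + 1/2)" if "i \<le> x - 2" for i
    using that assms(3) by (intro U) (simp add: x_def, linarith)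
  moreover have "P (real_of_int i)" if "x \<le> i" for i
    using that by (intro P) (simp_all add: x_def, linarith+)
  ultimately have "\<forall>i\<in>{0..<m}. (i \<le> x - 2 \<longrightarrow> U (real_of_int i + 1/2)) \<and>
      (x \<le> i \<and> i \<le> (max x m + 2) - 2 \<longrightarrow> P (real_of_int i)) \<and> ((max x m + 2) - 1 \<le> i \<longrightarrow> V i)"
    by auto
  moreover have "x < max x m + 2" by linarith
  ultimately show ?thesis unfolding alternates_A_def by blast
qed

lemma alternates_A_skip:
  fixes a b :: real
  assumes U: "\<And>t. t < a \<Longrightarrow> U t" and V: "\<And>t. b < t \<Longrightarrow> V t" and "b - 1 < a"
  shows "alternates_A m (\<lambda>i. U (real_of_int i + 1/2)) P (\<lambda>i. V (real_of_int i + 1/2))"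
proof -
  define x where "x = \<lfloor>b + 1/2\<rfloor>"
  have "U (real_of_int i + 1/2)" if "i \<le> x - 2" for i
    using that assms(3) by (intro U) (simp add: x_def, linarith)
  moreover have "V (real_of_int i + 1/2)" if "x \<le> i" for i
    using that by (intro V) (simp_all add: x_def, linarith+)
  ultimately have "\<forall>i\<in>{0..<m}. (i \<le> x - 2 \<longrightarrow> U (real_of_int i + 1/2)) \<and>
      (x \<le> i \<and> i \<le> (x + 1) - 2 \<longrightarrow> P i) \<and> ((x + 1) - 1 \<le> i \<longrightarrow> V (real_of_int i + 1/2))"
    by auto
  moreover have "x < x + 1" by linarith
  ultimately show ?thesis unfolding alternates_A_def by blast
qed

lemma alternates_B_two:
  fixes a b :: real
  assumes P: "\<And>t. t < a \<Longrightarrow> P t" and U: "\<And>t. b < t \<Longrightarrow> U t" and "b < a + 1/2"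
  shows "alternates_B m (\<lambda>i. P (real_of_int i)) (\<lambda>i. U (real_of_int i + 1/2))"
proof -
  define x where "x = \<lceil>a\<rceil> + 1"
  have "P (real_of_int i)" if "i \<le> x - 2" for i
    using that by (intro P(1)) (simp add: x_def, linarith)
  moreover have "U (real_of_int i + 1/2)" if "x - 1 \<le> i" for i
    using that assms(3) by (intro U) (simp_all add: x_def, linarith+)
  ultimately have "\<forall>i\<in>{0..<m}. (i \<le> x - 2 \<longrightarrow> P (real_of_int i)) \<and>
      (x - 1 \<le> i \<and> i \<le> (max x m + 2) - 2 \<longrightarrow> U (real_of_int i + 1/2)) \<and> (max x m + 2 \<le> i \<longrightarrow> P (real_of_int i))"
    by auto
  moreover have "x \<le> max x m + 2" by linarith
  ultimately show ?thesis unfolding alternates_B_def by blast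
qed

lemma alternates_B_all: "(\<And>i. P i) \<Longrightarrow> alternates_B m P U"
  unfolding alternates_B_def by (rule exI[of _ 0], rule exI[of _ 0]) auto

lemma alternates_A_all: "(\<And>i. U i) \<Longrightarrow> alternates_A m U P V"
  unfolding alternates_A_def by (rule exI[of _ "m + 2"], rule exI[of _ "m + 3"]) auto

section \<open>Sign patterns of quadratic and affine functions\<close>

lemma quadratic_pos_or_roots:
  fixes \<alpha> \<beta> \<gamma> :: real
  assumes "\<alpha> > 0"
  shows "(\<forall>t. \<alpha> * t\<^sup>2 + \<beta> * t + \<gamma> > 0) \<or>
    (\<exists>a b. a \<le> b \<and> \<beta> = - \<alpha> * (a + b) \<and> \<gamma> = \<alpha> * a * b)"
proof (cases "\<beta>\<^sup>2 - 4 * \<alpha> * \<gamma> < 0")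
  case True
  have "\<alpha> * t\<^sup>2 + \<beta> * t + \<gamma> > 0" for t
  proof -
    have "4 * \<alpha> * (\<alpha> * t\<^sup>2 + \<beta> * t + \<gamma>) = (2 * \<alpha> * t + \<beta>)\<^sup>2 - (\<beta>\<^sup>2 - 4 * \<alpha> * \<gamma>)"
      by (simp add: power2_eq_square algebra_simps)
    also have "\<dots> > 0" using True by (meson diff_gt_0_iff_gt le_less_trans less_le_trans not_le zero_le_power2)
    finally show ?thesis using assms by (simp add: zero_less_mult_iff)
  qed
  then show ?thesis by blast
next
  case False
  define d where "d = sqrt (\<beta>\<^sup>2 - 4 * \<alpha> * \<gamma>)"
  have d: "d \<ge> 0" "d * d = \<beta>\<^sup>2 - 4 * \<alpha> * \<gamma>" using False by (auto simp: d_def)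
  let ?a = "(- \<beta> - d) / (2 * \<alpha>)" and ?b = "(- \<beta> + d) / (2 * \<alpha>)"
  have "?a \<le> ?b" using d assms by (intro divide_right_mono) auto
  moreover have "\<beta> = - \<alpha> * (?a + ?b)" using assms by (simp add: field_simps)
  moreover have "\<alpha> * ?a * ?b = (\<beta>\<^sup>2 - d * d) / (4 * \<alpha>)"
    using assms by (simp add: field_simps power2_eq_square)
  then have "\<gamma> = \<alpha> * ?a * ?b" using assms by (simp add: d(2))
  ultimately show ?thesis by blast
qed

lemma quadratic_sign:
  fixes \<alpha> a b t :: real
  assumes "\<alpha> > 0" "a \<le> b"
  shows "t < a \<Longrightarrow> 0 < \<alpha> * t\<^sup>2 + (- \<alpha> * (a + b)) * t + \<alpha> * a * b"
    and "b < t \<Longrightarrow> 0 < \<alpha> * t\<^sup>2 + (- \<alpha> * (a + b)) * t + \<alpha> * a * b"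
    and "a < t \<Longrightarrow> t < b \<Longrightarrow> \<alpha> * t\<^sup>2 + (- \<alpha> * (a + b)) * t + \<alpha> * a * b < 0"
proof -
  have *: "\<alpha> * t\<^sup>2 + (- \<alpha> * (a + b)) * t + \<alpha> * a * b = \<alpha> * ((t - a) * (t - b))"
    by (simp add: algebra_simps power2_eq_square)
  show "t < a \<Longrightarrow> 0 < \<alpha> * t\<^sup>2 + (- \<alpha> * (a + b)) * t + \<alpha> * a * b"
    "b < t \<Longrightarrow> 0 < \<alpha> * t\<^sup>2 + (- \<alpha> * (a + b)) * t + \<alpha> * a * b"
    "a < t \<Longrightarrow> t < b \<Longrightarrow> \<alpha> * t\<^sup>2 + (- \<alpha> * (a + b)) * t + \<alpha> * a * b < 0"
    unfolding * using assms by (auto intro!: mult_pos_pos mult_neg_neg mult_pos_neg mult_neg_pos simp: mult_less_0_iff zero_less_mult_iff)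
qed

text \<open>The four shapes are the positions of the two vertices that a crossing omits: both in the
  first half of the polygon, both in the second, or one in each half, the last in two
  variants.\<close>

definition alternation :: "int \<Rightarrow> (int \<Rightarrow> bool) \<Rightarrow> (int \<Rightarrow> bool) \<Rightarrow> (int \<Rightarrow> bool) \<Rightarrow> bool" where
  "alternation m P Q1 Q2 \<longleftrightarrow> alternates_A m Q1 P Q2 \<or> alternates_A m Q2 P Q1 \<or>
     alternates_B m P Q1 \<or> alternates_B m P Q2"

lemma alternation_mono:
  assumes "alternation m P Q1 Q2" "\<And>i. 0 \<le> i \<Longrightarrow> i < m \<Longrightarrow> P i \<Longrightarrow> P' i"
    "\<And>i. 0 \<le> i \<Longrightarrow> i < m \<Longrightarrow> Q1 i \<Longrightarrow> Q1' i" "\<And>i. 0 \<le> i \<Longrightarrow> i < m \<Longrightarrow> Q2 i \<Longrightarrow> Q2' i"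
  shows "alternation m P' Q1' Q2'"
proof -
  have "alternates_A m Q1' P' Q2'" if "alternates_A m Q1 P Q2"
    using that by (rule alternates_A_mono) (use assms(2-4) in auto)
  moreover have "alternates_A m Q2' P' Q1'" if "alternates_A m Q2 P Q1"
    using that by (rule alternates_A_mono) (use assms(2-4) in auto)
  moreover have "alternates_B m P' Q1'" if "alternates_B m P Q1"
    using that by (rule alternates_B_mono) (use assms(2-4) in auto)
  moreover have "alternates_B m P' Q2'" if "alternates_B m P Q2"
    using that by (rule alternates_B_mono) (use assms(2-4) in auto)
  ultimately show ?thesis using assms(1) unfolding alternation_def by blast
qed

definition one_signed :: "int \<Rightarrow> (real \<Rightarrow> real) \<Rightarrow> (real \<Rightarrow> real) \<Rightarrow> (real \<Rightarrow> real) \<Rightarrow> bool" where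
  "one_signed m p q1 q2 \<longleftrightarrow>
     alternation m (\<lambda>i. p (real_of_int i) > 0) (\<lambda>i. q1 (real_of_int i + 1/2) > 0) (\<lambda>i. q2 (real_of_int i + 1/2) > 0) \<or>
     alternation m (\<lambda>i. p (real_of_int i) < 0) (\<lambda>i. q1 (real_of_int i + 1/2) < 0) (\<lambda>i. q2 (real_of_int i + 1/2) < 0)"

lemma one_signed_swap: "one_signed m p q2 q1 \<Longrightarrow> one_signed m p q1 q2"
  by (auto simp: one_signed_def alternation_def)

lemma one_signed_uminus: "one_signed m (\<lambda>t. - p t) (\<lambda>t. - q1 t) (\<lambda>t. - q2 t) \<Longrightarrow> one_signed m p q1 q2"
  by (auto simp: one_signed_def)

text \<open>If no alternation is one-signed, then the four roots of \<open>q1\<close> and \<open>q2\<close> lie all to the right, or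
  all to the left, of the corresponding roots of \<open>p\<close>; but the sum of the former is twice the sum of the
  latter.\<close>

lemma one_signed_convex:
  fixes \<alpha> \<beta> \<gamma> b1 c1 b2 c2 :: real
  assumes "\<alpha> > 0" "b1 + b2 = - \<beta>"
  shows "one_signed m (\<lambda>t. \<alpha> * t\<^sup>2 + \<beta> * t + \<gamma>) (\<lambda>t. - (\<alpha>/2) * t\<^sup>2 + b1 * t + c1)
    (\<lambda>t. - (\<alpha>/2) * t\<^sup>2 + b2 * t + c2)" (is "one_signed m ?p ?q1 ?q2")
proof (rule ccontr)
  assume neg: "\<not> ?thesis"
  note A = alternates_A_all alternates_B_all
  have "\<not> (\<forall>t. ?p t > 0)"
    using neg A(2)[of "\<lambda>i. ?p (real_of_int i) > 0"] unfolding one_signed_def alternation_def by blast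
  then obtain a b where p: "a \<le> b" "\<beta> = - \<alpha> * (a + b)" "\<gamma> = \<alpha> * a * b"
    using quadratic_pos_or_roots[of \<alpha> \<beta> \<gamma>] assms by blast
  have "\<not> (\<forall>t. ?q1 t < 0)" "\<not> (\<forall>t. ?q2 t < 0)"
    using neg A(1)[of "\<lambda>i. ?q1 (real_of_int i + 1/2) < 0"] A(1)[of "\<lambda>i. ?q2 (real_of_int i + 1/2) < 0"]
    unfolding one_signed_def alternation_def by blast+
  then have n: "\<not> (\<forall>t. (\<alpha>/2) * t\<^sup>2 + (- b1) * t + (- c1) > 0)" "\<not> (\<forall>t. (\<alpha>/2) * t\<^sup>2 + (- b2) * t + (- c2) > 0)"
    by (force simp: algebra_simps)+
  have "\<alpha>/2 > 0" using assms by simp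
  from quadratic_pos_or_roots[OF this, of "- b1" "- c1"] n(1) obtain d1 e1 where
    q1: "d1 \<le> e1" "- b1 = - (\<alpha>/2) * (d1 + e1)" "- c1 = (\<alpha>/2) * d1 * e1" by (elim disjE exE conjE) simp_all
  from quadratic_pos_or_roots[OF \<open>\<alpha>/2 > 0\<close>, of "- b2" "- c2"] n(2) obtain d2 e2 where
    q2: "d2 \<le> e2" "- b2 = - (\<alpha>/2) * (d2 + e2)" "- c2 = (\<alpha>/2) * d2 * e2" by (elim disjE exE conjE) simp_all
  have P: "t < a \<Longrightarrow> ?p t > 0" "b < t \<Longrightarrow> ?p t > 0" "a < t \<Longrightarrow> t < b \<Longrightarrow> ?p t < 0" for t
    unfolding p(2,3) using quadratic_sign[OF assms(1) p(1)] by blast+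
  have fac1: "?q1 t = - (\<alpha>/2 * t\<^sup>2 + (- (\<alpha>/2) * (d1 + e1)) * t + \<alpha>/2 * d1 * e1)" for t
    unfolding q1(2,3)[symmetric] by simp
  have Q1: "t < d1 \<Longrightarrow> ?q1 t < 0" "e1 < t \<Longrightarrow> ?q1 t < 0" "d1 < t \<Longrightarrow> t < e1 \<Longrightarrow> ?q1 t > 0" for t
    unfolding fac1 neg_less_0_iff_less neg_0_less_iff_less using quadratic_sign[OF \<open>\<alpha>/2 > 0\<close> q1(1)] by blast+
  have fac2: "?q2 t = - (\<alpha>/2 * t\<^sup>2 + (- (\<alpha>/2) * (d2 + e2)) * t + \<alpha>/2 * d2 * e2)" for t
    unfolding q2(2,3)[symmetric] by simp
  have Q2: "t < d2 \<Longrightarrow> ?q2 t < 0" "e2 < t \<Longrightarrow> ?q2 t < 0" "d2 < t \<Longrightarrow> t < e2 \<Longrightarrow> ?q2 t > 0" for t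
    unfolding fac2 neg_less_0_iff_less neg_0_less_iff_less using quadratic_sign[OF \<open>\<alpha>/2 > 0\<close> q2(1)] by blast+
  have 1: "\<not> (a - 1/2 < d1 \<and> e2 < b + 1/2)"
    using alternates_A_thresholds[where U = "\<lambda>t. ?q1 t < 0" and P = "\<lambda>t. ?p t < 0" and V = "\<lambda>t. ?q2 t < 0",
      OF Q1(1) P(3) Q2(2) p(1), where m = m] neg unfolding one_signed_def alternation_def by blast
  have 2: "\<not> (a - 1/2 < d2 \<and> e1 < b + 1/2)"
    using alternates_A_thresholds[where U = "\<lambda>t. ?q2 t < 0" and P = "\<lambda>t. ?p t < 0" and V = "\<lambda>t. ?q1 t < 0",
      OF Q2(1) P(3) Q1(2) p(1), where m = m] neg unfolding one_signed_def alternation_def by blast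
  have 3: "\<not> (d1 < a + 1/2 \<and> b - 1/2 < e1)"
    using alternates_B_thresholds[where P = "\<lambda>t. ?p t > 0" and U = "\<lambda>t. ?q1 t > 0",
      OF P(1,2) Q1(3) p(1), where m = m] neg unfolding one_signed_def alternation_def by blast
  have 4: "\<not> (d2 < a + 1/2 \<and> b - 1/2 < e2)"
    using alternates_B_thresholds[where P = "\<lambda>t. ?p t > 0" and U = "\<lambda>t. ?q2 t > 0",
      OF P(1,2) Q2(3) p(1), where m = m] neg unfolding one_signed_def alternation_def by blast
  have "\<alpha> * (d1 + e1 + d2 + e2) = \<alpha> * (2 * (a + b))"
    using q1(2) q2(2) p(2) assms(2) by (simp add: algebra_simps)
  then have "d1 + e1 + d2 + e2 = 2 * (a + b)" using assms(1) by (simp only: mult_cancel_left) simp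
  \<comment> \<open>By \<open>1\<close>, either \<open>d1 \<le> a - 1/2\<close> or
    \<open>e2 \<ge> b + 1/2\<close>. The first option gives, through \<open>3\<close>,
    \<open>2\<close>, \<open>4\<close>, also \<open>e1 \<le> b - 1/2\<close>,
    \<open>d2 \<le> a - 1/2\<close> and \<open>e2 \<le> b - 1/2\<close>; the second, through
    \<open>4\<close>, \<open>2\<close>, \<open>3\<close>, pushes all four roots the other way.
    Neither fits the sum of the roots.\<close>
  then show False using 1 2 3 4 by argo
qed

lemma affine_sign:
  fixes b c t :: real
  shows "b > 0 \<Longrightarrow> - c / b < t \<Longrightarrow> b * t + c > 0" "b > 0 \<Longrightarrow> t < - c / b \<Longrightarrow> b * t + c < 0"
    and "b < 0 \<Longrightarrow> - c / b < t \<Longrightarrow> b * t + c < 0" "b < 0 \<Longrightarrow> t < - c / b \<Longrightarrow> b * t + c > 0"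
  by (auto simp: field_simps)

text \<open>The order of the two roots decides between positive \<open>q1\<close> followed by
  positive \<open>p\<close> and negative \<open>p\<close> followed by negative \<open>q1\<close>;
  the slacks of the two patterns overlap.\<close>

lemma one_signed_affine_decreasing:
  fixes \<beta> \<gamma> b1 c1 :: real
  assumes "\<beta> > 0" "b1 < 0"
  shows "one_signed m (\<lambda>t. \<beta> * t + \<gamma>) (\<lambda>t. b1 * t + c1) q2"
proof (cases "- \<gamma> / \<beta> - 1/2 < - c1 / b1")
  case True
  have "alternates_A m (\<lambda>i. b1 * (real_of_int i + 1/2) + c1 > 0) (\<lambda>i. \<beta> * real_of_int i + \<gamma> > 0)
      (\<lambda>i. q2 (real_of_int i + 1/2) > 0)"
    using assms by (intro alternates_A_two[OF _ _ True]) (auto intro: affine_sign)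
  then show ?thesis unfolding one_signed_def alternation_def by blast
next
  case False
  have "alternates_B m (\<lambda>i. \<beta> * real_of_int i + \<gamma> < 0) (\<lambda>i. b1 * (real_of_int i + 1/2) + c1 < 0)"
    using assms False
    by (intro alternates_B_two[where a = "- \<gamma> / \<beta>" and b = "- c1 / b1"]) (auto intro: affine_sign)
  then show ?thesis unfolding one_signed_def alternation_def by blast
qed

lemma one_signed_affine:
  fixes \<beta> \<gamma> b1 c1 b2 c2 :: real
  assumes "\<beta> > 0" "b1 + b2 = - \<beta>"
  shows "one_signed m (\<lambda>t. \<beta> * t + \<gamma>) (\<lambda>t. b1 * t + c1) (\<lambda>t. b2 * t + c2)"
proof (cases "b1 < 0")
  case True
  then show ?thesis by (rule one_signed_affine_decreasing[OF assms(1)])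
next
  case False
  then have "b2 < 0" using assms by linarith
  then show ?thesis by (intro one_signed_swap[OF one_signed_affine_decreasing] assms(1))
qed

text \<open>As the first function is zero, only patterns without a stretch for it can serve. They
  tolerate a gap below 1 between the two roots, so at least one of the two signs works.\<close>

lemma one_signed_slope:
  fixes b c1 c2 :: real
  assumes "b > 0"
  shows "one_signed m (\<lambda>t. 0) (\<lambda>t. b * t + c1) (\<lambda>t. - b * t + c2)"
proof -
  have q1: "- c1 / b < t \<Longrightarrow> b * t + c1 > 0" "t < - c1 / b \<Longrightarrow> b * t + c1 < 0" for t
    using affine_sign assms by blast+
  have q2: "c2 / b < t \<Longrightarrow> - b * t + c2 < 0" "t < c2 / b \<Longrightarrow> - b * t + c2 > 0" for t
    using assms by (simp_all add: field_simps)
  show ?thesis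
  proof (cases "- c1 / b - 1 < c2 / b")
    case True
    show ?thesis
      using alternates_A_skip[where U = "\<lambda>t. - b * t + c2 > 0" and V = "\<lambda>t. b * t + c1 > 0",
        OF q2(2) q1(1) True, where m = m and P = "\<lambda>i. (0::real) > 0"]
      unfolding one_signed_def alternation_def by blast
  next
    case False
    then have "c2 / b - 1 < - c1 / b" by linarith
    from alternates_A_skip[where U = "\<lambda>t. b * t + c1 < 0" and V = "\<lambda>t. - b * t + c2 < 0",
        OF q1(2) q2(1) this, where m = m and P = "\<lambda>i. (0::real) < 0"]
    show ?thesis unfolding one_signed_def alternation_def by blast
  qed
qed

text \<open>By \<open>sum\<close> and the leading coefficients the three functions add up to a
  constant. The cases follow the degree of the first one and, if it is zero, the slopes and then the
  constants of the others; a negative leading coefficient is removed by negating all three.\<close>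

theorem one_signed_quadratics:
  fixes \<alpha> \<beta> \<gamma> b1 c1 b2 c2 :: real
  assumes sum: "b1 + b2 = - \<beta>" and nz: "\<not> (\<alpha> = 0 \<and> \<beta> = 0 \<and> \<gamma> = 0 \<and> b1 = 0 \<and> c1 = 0 \<and> c2 = 0)"
  shows "one_signed m (\<lambda>t. \<alpha> * t\<^sup>2 + \<beta> * t + \<gamma>) (\<lambda>t. - (\<alpha>/2) * t\<^sup>2 + b1 * t + c1)
    (\<lambda>t. - (\<alpha>/2) * t\<^sup>2 + b2 * t + c2)"
proof -
  consider "\<alpha> \<noteq> 0" | "\<alpha> = 0" "\<beta> \<noteq> 0" | "\<alpha> = 0" "\<beta> = 0" "\<gamma> \<noteq> 0" | "\<alpha> = 0" "\<beta> = 0" "\<gamma> = 0" "b1 \<noteq> 0"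
    | "\<alpha> = 0" "\<beta> = 0" "\<gamma> = 0" "b1 = 0" by blast
  then show ?thesis
  proof cases
    case 1
    show ?thesis
    proof (cases "\<alpha> > 0")
      case True
      then show ?thesis by (rule one_signed_convex[OF _ sum])
    next
      case False
      then have "one_signed m (\<lambda>t. - \<alpha> * t\<^sup>2 + - \<beta> * t + - \<gamma>) (\<lambda>t. - (- \<alpha> / 2) * t\<^sup>2 + - b1 * t + - c1)
          (\<lambda>t. - (- \<alpha> / 2) * t\<^sup>2 + - b2 * t + - c2)"
        using sum 1 by (intro one_signed_convex) auto
      then have "one_signed m (\<lambda>t. - (\<alpha> * t\<^sup>2 + \<beta> * t + \<gamma>)) (\<lambda>t. - (- (\<alpha> / 2) * t\<^sup>2 + b1 * t + c1))
          (\<lambda>t. - (- (\<alpha> / 2) * t\<^sup>2 + b2 * t + c2))"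
        by (simp add: algebra_simps)
      then show ?thesis by (rule one_signed_uminus)
    qed
  next
    case 2
    show ?thesis
    proof (cases "\<beta> > 0")
      case True
      then show ?thesis using one_signed_affine[OF _ sum] 2 by simp
    next
      case False
      then have "one_signed m (\<lambda>t. - \<beta> * t + - \<gamma>) (\<lambda>t. - b1 * t + - c1) (\<lambda>t. - b2 * t + - c2)"
        using sum 2 by (intro one_signed_affine) auto
      then have "one_signed m (\<lambda>t. - (\<alpha> * t\<^sup>2 + \<beta> * t + \<gamma>)) (\<lambda>t. - (- (\<alpha> / 2) * t\<^sup>2 + b1 * t + c1))
          (\<lambda>t. - (- (\<alpha> / 2) * t\<^sup>2 + b2 * t + c2))"
        using 2 by (simp add: algebra_simps)
      then show ?thesis by (rule one_signed_uminus)
    qed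
  next
    case 3
    then show ?thesis
      by (cases "\<gamma> > 0") (auto simp: one_signed_def alternation_def intro: alternates_B_all)
  next
    case 4
    have "b2 = - b1" using sum 4 by simp
    show ?thesis
    proof (cases "b1 > 0")
      case True
      then show ?thesis using one_signed_slope[of b1 m c1 c2] 4 \<open>b2 = - b1\<close> by simp
    next
      case False
      then show ?thesis using one_signed_swap[OF one_signed_slope[of b2 m c2 c1]] 4 \<open>b2 = - b1\<close> by simp
    qed
  next
    case 5
    then have "b2 = 0" "c1 \<noteq> 0 \<or> c2 \<noteq> 0" using sum nz by auto
    then consider "c1 > 0" | "c1 < 0" | "c2 > 0" | "c2 < 0" by linarith
    then show ?thesis using 5 \<open>b2 = 0\<close>
      by cases (auto simp: one_signed_def alternation_def intro: alternates_A_all)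
  qed
qed


section \<open>Reduced words of the longest element\<close>

text \<open>The reduced words of the longest element of the symmetric group \<open>S\<^sub>4\<close>, with the letters \<open>0, 1, 2\<close> standing
  for the generators \<open>s\<^sub>2, s\<^sub>1, s\<^sub>3\<close>, as in the word \<open>(s\<^sub>2 s\<^sub>1 s\<^sub>3)\<^sup>k\<^sup>+\<^sup>2\<close> of the columns.\<close>

definition longest_words :: "nat list list" where
  "longest_words =
    [[0,1,0,2,0,1], [0,1,2,0,1,2], [0,1,2,0,2,1], [0,2,0,1,0,2],
     [0,2,1,0,1,2], [0,2,1,0,2,1], [1,0,1,2,0,1], [1,0,2,0,1,0],
     [1,0,2,1,0,1], [1,2,0,1,2,0], [1,2,0,2,1,0], [2,0,1,0,2,0],
     [2,0,1,2,0,2], [2,0,2,1,0,2], [2,1,0,1,2,0], [2,1,0,2,1,0]]"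

definition insert_at :: "nat \<Rightarrow> 'a \<Rightarrow> 'a list \<Rightarrow> 'a list" where
  "insert_at p s w = take p w @ s # drop p w"

definition delete_at :: "nat \<Rightarrow> 'a list \<Rightarrow> 'a list" where
  "delete_at q w = take q w @ drop (Suc q) w"

text \<open>The exchange property of reduced words, checked on all 16 words. The condition
  \<open>q \<noteq> p\<close> keeps the inserted letter from being the one deleted.\<close>

lemma longest_words_exchange:
  "\<forall>w\<in>set longest_words. \<forall>p\<in>set [0..<7]. \<forall>s\<in>set [0..<3]. \<exists>q\<in>set [0..<7].
     q \<noteq> p \<and> delete_at q (insert_at p s w) \<in> set longest_words"
  by code_simp

lemma longest_words_length: "\<forall>w\<in>set longest_words. length w = 6"
  by code_simp

text \<open>One pattern for each position of the two vertices omitted by a crossing;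
  \<open>crossing_meets_longest_subword\<close> uses the letters in exactly these orders.\<close>

lemma longest_words_subsequence:
  "\<forall>w\<in>set longest_words. \<forall>v\<in>set [[1,0,2], [2,0,1], [0,1,0], [0,2,0]].
    \<exists>i\<in>set [0..<6]. \<exists>j\<in>set [Suc i..<6]. \<exists>l\<in>set [Suc j..<6]. [w ! i, w ! j, w ! l] = v"
  by code_simp

text \<open>The complements of these sets are the facets of the subword complex of the first
  \<open>n\<close> letters and the longest element.\<close>

definition longest_subwords :: "nat \<Rightarrow> nat set set" where
  "longest_subwords n = {B. B \<subseteq> {..<n} \<and> map (\<lambda>j. j mod 3) (sorted_list_of_set B) \<in> set longest_words}"

lemma longest_subwords_length:
  assumes "B \<in> longest_subwords n"
  shows "finite B" "length (sorted_list_of_set B) = 6" "card B = 6"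
proof -
  show "finite B" using assms by (auto simp: longest_subwords_def intro: finite_subset)
  show "length (sorted_list_of_set B) = 6"
    using assms longest_words_length by (auto simp: longest_subwords_def)
  then show "card B = 6" by simp
qed

lemma longest_subwords_nonempty:
  assumes "n \<ge> 6"
  shows "longest_subwords n \<noteq> {}"
proof -
  have "{..<6} \<in> longest_subwords n"
    using assms by (auto simp: longest_subwords_def lessThan_atLeast0 longest_words_def upt_rec)
  then show ?thesis by blast
qed

lemma map_insert_at: "map f (insert_at p s w) = insert_at p (f s) (map f w)"
  by (simp add: insert_at_def take_map drop_map)

lemma map_delete_at: "map f (delete_at q w) = delete_at q (map f w)"
  by (simp add: delete_at_def take_map drop_map)

lemma insort_eq_insert_at: "\<exists>p\<le>length xs. insort x xs = insert_at p x xs"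
proof (induction xs)
  case (Cons y ys)
  then obtain p where "p \<le> length ys" "insort x ys = insert_at p x ys" by blast
  then show ?case
    by (cases "x \<le> y") (auto simp: insert_at_def intro: exI[of _ 0] exI[of _ "Suc p"])
qed (simp add: insert_at_def)

lemma longest_subwords_exchange:
  assumes B: "B \<in> longest_subwords n" and e: "e \<in> {..<n} - B"
  shows "\<exists>e'\<in>B. insert e (B - {e'}) \<in> longest_subwords n"
proof -
  note fin = longest_subwords_length[OF B]
  define xs where "xs = sorted_list_of_set B"
  obtain p where p: "p \<le> length xs" "insort e xs = insert_at p e xs" using insort_eq_insert_at by blast
  define ys where "ys = insert_at p e xs"
  have ys: "ys = sorted_list_of_set (insert e B)"
    using e fin by (simp add: ys_def xs_def p(2)[unfolded xs_def, symmetric])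
  have len: "length xs = 6" "length ys = 7" using fin e by (simp_all add: ys xs_def)
  have w: "map (\<lambda>j. j mod 3) xs \<in> set longest_words" using B by (simp add: longest_subwords_def xs_def)
  have "\<exists>q\<in>set [0..<7]. q \<noteq> p \<and>
      delete_at q (insert_at p (e mod 3) (map (\<lambda>j. j mod 3) xs)) \<in> set longest_words"
    using longest_words_exchange[rule_format, OF w, of p "e mod 3"] p len by simp
  then obtain q where q: "q < 7" "q \<noteq> p"
    "delete_at q (insert_at p (e mod 3) (map (\<lambda>j. j mod 3) xs)) \<in> set longest_words" by auto
  then have del: "map (\<lambda>j. j mod 3) (delete_at q ys) \<in> set longest_words"
    by (simp add: ys_def map_delete_at map_insert_at)
  have dist: "distinct ys" and sorted: "sorted_wrt (<) ys" and set: "set ys = insert e B"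
    using fin by (simp_all add: ys del: sorted_list_of_set_insert_remove)
  have "ys ! p = e" using p len by (simp add: ys_def insert_at_def nth_append)
  then have ne: "ys ! q \<noteq> e" using dist q p len by (metis distinct_conv_nth less_Suc_eq_le numeral_eq_Suc pred_numeral_simps(3))
  then have "ys ! q \<in> B" using set q len by (metis insertE nth_mem)
  have split: "ys = take q ys @ ys ! q # drop (Suc q) ys" using q len by (simp add: id_take_nth_drop)
  then have "distinct (take q ys @ ys ! q # drop (Suc q) ys)" "set (take q ys @ ys ! q # drop (Suc q) ys) = insert e B"
    using dist set by simp_all
  then have "set (delete_at q ys) = insert e B - {ys ! q}"
    by (auto simp: delete_at_def)
  also have "\<dots> = insert e (B - {ys ! q})" using ne by auto
  finally have set': "set (delete_at q ys) = insert e (B - {ys ! q})" .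
  have "sorted_wrt (<) (take q ys @ ys ! q # drop (Suc q) ys)" using sorted split by simp
  then have "sorted_wrt (<) (delete_at q ys)" by (simp add: delete_at_def sorted_wrt_append)
  then have "sorted_list_of_set (insert e (B - {ys ! q})) = delete_at q ys"
    unfolding set'[symmetric] by (intro sorted_list_of_set.idem_if_sorted_distinct) (auto simp: strict_sorted_iff)
  then have "insert e (B - {ys ! q}) \<in> longest_subwords n"
    using del B e by (auto simp: longest_subwords_def)
  then show ?thesis using \<open>ys ! q \<in> B\<close> by blast
qed

lemma longest_subwords_subsequence:
  assumes B: "B \<in> longest_subwords n" and "[r, s, t] \<in> {[1,0,2], [2,0,1], [0,1,0], [0,2,0]}"
  obtains j1 j2 j3 where "j1 \<in> B" "j2 \<in> B" "j3 \<in> B" "j1 < j2" "j2 < j3" "j3 < n"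
    "j1 mod 3 = r" "j2 mod 3 = s" "j3 mod 3 = t"
proof -
  note fin = longest_subwords_length[OF B]
  define xs where "xs = sorted_list_of_set B"
  have w: "map (\<lambda>j. j mod 3) xs \<in> set longest_words" using B by (simp add: longest_subwords_def xs_def)
  have "[r, s, t] \<in> set [[1,0,2], [2,0,1], [0,1,0], [0,2,0]]" using assms(2) by simp
  from longest_words_subsequence[rule_format, OF w this]
  obtain i j l where ijl: "i < j" "j < l" "l < 6"
    "map (\<lambda>j. j mod 3) xs ! i = r" "map (\<lambda>j. j mod 3) xs ! j = s" "map (\<lambda>j. j mod 3) xs ! l = t"
    by (auto simp: Suc_le_eq)
  have len: "length xs = 6" using fin by (simp add: xs_def)
  have "sorted_wrt (<) xs" by (simp add: xs_def)
  then have "xs ! i < xs ! j" "xs ! j < xs ! l"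
    using ijl len by (simp_all add: sorted_wrt_iff_nth_less)
  moreover have "xs ! i \<in> B" "xs ! j \<in> B" "xs ! l \<in> B"
    using ijl len fin nth_mem[of _ xs] by (simp_all add: xs_def)
  moreover have "xs ! l < n" using \<open>xs ! l \<in> B\<close> B by (auto simp: longest_subwords_def)
  ultimately show ?thesis using ijl len by (intro that[of "xs ! i" "xs ! j" "xs ! l"]) simp_all
qed


section \<open>Columns and crossings\<close>

lemma relevant_iff:
  assumes "k \<ge> 1"
  shows "(a, b) \<in> relevant_diagonals (2 * k + 4) k \<longleftrightarrow>
    1 \<le> a \<and> b \<le> 2 * k + 4 \<and> (b = a + k + 1 \<or> b = a + k + 2 \<or> b = a + k + 3)"
  using assms by (auto simp: relevant_diagonals_iff)

lemma finite_relevant: "finite (relevant_diagonals l k)"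
proof (rule finite_subset)
  show "relevant_diagonals l k \<subseteq> {1..l} \<times> {1..l}"
    by (auto simp: relevant_diagonals_def is_crossing_def diagonals_def)
qed simp

lemma relevant_cases:
  assumes "k \<ge> 1" "(a, b) \<in> relevant_diagonals (2 * k + 4) k"
  obtains c r where "a = c + 1" "b = c + k + 2 + r" "r < 3" "c + r \<le> k + 2"
proof -
  have "1 \<le> a" "b \<le> 2 * k + 4" "b = a + k + 1 \<or> b = a + k + 2 \<or> b = a + k + 3"
    using assms(2) unfolding relevant_iff[OF assms(1)] by auto
  then have "a = (a - 1) + 1" "b = (a - 1) + k + 2 + (b - a - k - 1)" "b - a - k - 1 < 3"
    "(a - 1) + (b - a - k - 1) \<le> k + 2" by linarith+
  then show thesis by (rule that)
qed

text \<open>Vertices up to \<open>k + 1\<close> start three diagonals each, vertex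
  \<open>k + 2\<close> starts two and \<open>k + 3\<close> one. So \<open>3 * (a - 1)\<close> plus
  the excess of the length over \<open>k + 1\<close> is right except for the last diagonal, where it
  is one too large.\<close>

lemma lex_position_eq:
  assumes k: "k \<ge> 1" and ab: "(a, b) \<in> relevant_diagonals (2 * k + 4) k"
  shows "lex_position k (a, b) = (if a = k + 3 then 3 * k + 5 else 3 * (a - 1) + (b - a - k - 1))"
proof -
  define N where "N = (\<lambda>(a, b). if a = k + 3 then 3 * k + 5 else 3 * (a - 1) + (b - a - k - 1))"
  let ?R = "relevant_diagonals (2 * k + 4) k"
  let ?less = "less_than <*lex*> less_than"
  have N: "N (c + 1, c + k + 2 + r) = (if c = k + 2 then 3 * k + 5 else 3 * c + r)" for c r
    by (simp add: N_def)
  have mono: "N d < N e" if "(d, e) \<in> ?less" "d \<in> ?R" "e \<in> ?R" for d e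
  proof -
    obtain a b a' b' where de: "d = (a, b)" "e = (a', b')" by (cases d, cases e)
    obtain c r where c: "a = c + 1" "b = c + k + 2 + r" "r < 3" "c + r \<le> k + 2"
      using relevant_cases[OF k] \<open>d \<in> ?R\<close> unfolding de by blast
    obtain c' r' where c': "a' = c' + 1" "b' = c' + k + 2 + r'" "r' < 3" "c' + r' \<le> k + 2"
      using relevant_cases[OF k] \<open>e \<in> ?R\<close> unfolding de by blast
    have "c < c' \<or> c = c' \<and> r < r'" using that(1) unfolding de c c' by auto
    then show ?thesis
      unfolding de c c' N using c(3,4) c'(3,4) by (auto split: if_splits)
  qed
  have total: "(d, e) \<in> ?less \<or> (e, d) \<in> ?less" if "d \<noteq> e" for d e :: "nat \<times> nat"
    using that by (cases d; cases e) auto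
  have less_iff: "(d, e) \<in> ?less \<longleftrightarrow> N d < N e" if "d \<in> ?R" "e \<in> ?R" for d e
    using mono[of d e] mono[of e d] total[of d e] that by (metis less_asym less_irrefl)
  have surj: "\<exists>d\<in>?R. n = N d" if "n \<le> 3 * k + 5" for n
  proof -
    have "n = 3 * k + 5 \<or> (\<exists>c r. n = 3 * c + r \<and> r < 3 \<and> c + r \<le> k + 2 \<and> c < k + 2)"
    proof (cases "n = 3 * k + 5")
      case False
      obtain c r where cr: "n = 3 * c + r" "r < 3" by (metis mod_less_divisor mult_div_mod_eq zero_less_numeral)
      then have "r = 0 \<or> r = 1 \<or> r = 2" by linarith
      then have "c + r \<le> k + 2 \<and> c < k + 2" using cr that False by (elim disjE) simp_all
      then show ?thesis using cr by blast
    qed simp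
    then show ?thesis
    proof (elim disjE exE conjE)
      assume "n = 3 * k + 5"
      then show ?thesis
        using k by (intro bexI[of _ "(k + 3, 2 * k + 4)"]) (auto simp: N_def relevant_iff[OF k])
    next
      fix c r assume "n = 3 * c + r" "r < 3" "c + r \<le> k + 2" "c < k + 2"
      then have "n = N (c + 1, c + k + 2 + r)" "(c + 1, c + k + 2 + r) \<in> ?R"
        unfolding N relevant_iff[OF k] by auto
      then show ?thesis by blast
    qed
  qed
  obtain c r where "a = c + 1" "b = c + k + 2 + r" "r < 3" "c + r \<le> k + 2"
    using relevant_cases[OF assms] by blast
  then have "N (a, b) \<le> 3 * k + 5" by (simp only: N) simp
  let ?L = "{e \<in> ?R. (e, (a, b)) \<in> ?less}"
  have "bij_betw N ?L {..<N (a, b)}"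
  proof (rule bij_betwI')
    fix d e assume "d \<in> ?L" "e \<in> ?L"
    then show "N d = N e \<longleftrightarrow> d = e"
      using total[of d e] mono[of d e] mono[of e d] by (metis (no_types, lifting) less_irrefl mem_Collect_eq)
  next
    fix d assume "d \<in> ?L"
    then show "N d \<in> {..<N (a, b)}" using mono ab by blast
  next
    fix n assume n: "n \<in> {..<N (a, b)}"
    then obtain d where "d \<in> ?R" "n = N d" using surj[of n] \<open>N (a, b) \<le> _\<close> by auto
    then have "d \<in> ?L" using n less_iff[OF _ ab] by blast
    then show "\<exists>x\<in>?L. n = N x" using \<open>n = N d\<close> by blast
  qed
  then have "card ?L = N (a, b)" using bij_betw_same_card by fastforce
  then show ?thesis by (simp add: lex_position_def N_def)
qed

text \<open>The length of a diagonal fixes its letter. Removing the first diagonal shifts positions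
  by one, which puts length \<open>k + 1\<close> into the preceding block; the transposition places
  the first diagonal on the \<open>s\<^sub>1\<close> of the last block.\<close>

lemma diagonal_column_eq:
  assumes k: "k \<ge> 1" and ab: "(a, b) \<in> relevant_diagonals (2 * k + 4) k"
  shows "diagonal_column k (a, b) =
    (if b = a + k + 2 then 3 * (a - 1)
     else if b = a + k + 3 then 3 * (a - 1) + 1
     else if a = 1 then 3 * (k + 1) + 1 else 3 * (a - 2) + 2)"
proof -
  have dc: "diagonal_column k (a, b) = Transposition.transpose (3 * k + 4) (3 * k + 5)
      (if p = 0 then 3 * k + 5 else p - 1)" if "lex_position k (a, b) = p" for p
    using that by (simp add: diagonal_column_def lex_column_def)
  have tr: "Transposition.transpose (3 * k + 4) (3 * k + 5) p = p" if "p < 3 * k + 4" for p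
    using that by (simp add: transpose_def)
  obtain c r where c: "a = c + 1" "b = c + k + 2 + r" "r < 3" "c + r \<le> k + 2"
    using relevant_cases[OF assms] by blast
  have lex: "lex_position k (a, b) = (if c = k + 2 then 3 * k + 5 else 3 * c + r)"
    unfolding lex_position_eq[OF assms] by (simp add: c)
  consider "r = 0" "c = 0" | c' where "r = 0" "c = c' + 1" "c' \<le> k" | "r = 0" "c = k + 2" | "r = 1" | "r = 2"
  proof -
    have "r = 0 \<and> c = 0 \<or> r = 0 \<and> c = (c - 1) + 1 \<and> c - 1 \<le> k \<or> r = 0 \<and> c = k + 2 \<or> r = 1 \<or> r = 2"
      using c(3,4) by linarith
    then show thesis using that by blast
  qed
  then show ?thesis
  proof cases
    case 1
    then show ?thesis unfolding dc[OF lex] by (simp add: c)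
  next
    case (2 c')
    then show ?thesis unfolding dc[OF lex] by (simp add: c tr)
  next
    case 3
    then show ?thesis unfolding dc[OF lex] by (simp add: c transpose_def)
  next
    case 4
    then show ?thesis unfolding dc[OF lex] using c(4) by (simp add: c(1,2) tr)
  next
    case 5
    then show ?thesis unfolding dc[OF lex] using c(4) by (simp add: c(1,2) tr)
  qed
qed

text \<open>In the last block \<open>(1, k + 2)\<close> continues the pattern
  \<open>(i + 1, i + k + 4)\<close>: at \<open>i = k + 1\<close> the second endpoint is
  \<open>2 * k + 5\<close>, which is vertex 1 again.\<close>

definition column_diagonal :: "nat \<Rightarrow> nat \<Rightarrow> nat \<times> nat" where
  "column_diagonal k j = (let i = j div 3 in
     if j mod 3 = 0 then (i + 1, i + k + 3)
     else if j mod 3 = 2 then (i + 2, i + k + 3)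
     else if i = k + 1 then (1, k + 2) else (i + 1, i + k + 4))"

lemma column_diagonal_simps:
  "column_diagonal k (3 * i) = (i + 1, i + k + 3)"
  "column_diagonal k (3 * i + 2) = (i + 2, i + k + 3)"
  "column_diagonal k (3 * i + 1) = (if i = k + 1 then (1, k + 2) else (i + 1, i + k + 4))"
proof -
  have "(3 * i + 2) div 3 = i" "(3 * i + 2) mod 3 = 2" "(3 * i + 1) div 3 = i" "(3 * i + 1) mod 3 = 1"
    by presburger+
  then show "column_diagonal k (3 * i) = (i + 1, i + k + 3)"
    "column_diagonal k (3 * i + 2) = (i + 2, i + k + 3)"
    "column_diagonal k (3 * i + 1) = (if i = k + 1 then (1, k + 2) else (i + 1, i + k + 4))"
    unfolding column_diagonal_def Let_def by simp_all
qed

lemma mod3_cases: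
  fixes j :: nat
  obtains i where "j = 3 * i" | i where "j = 3 * i + 1" | i where "j = 3 * i + 2"
proof -
  have "j = 3 * (j div 3) \<or> j = 3 * (j div 3) + 1 \<or> j = 3 * (j div 3) + 2" by presburger
  then show thesis using that by blast
qed

lemma bij_diagonal_column:
  assumes k: "k \<ge> 1"
  shows "bij_betw (diagonal_column k) (relevant_diagonals (2 * k + 4) k) {..<3 * k + 6}"
    and "j < 3 * k + 6 \<Longrightarrow> column_diagonal k j \<in> relevant_diagonals (2 * k + 4) k"
    and "j < 3 * k + 6 \<Longrightarrow> diagonal_column k (column_diagonal k j) = j"
    and "d \<in> relevant_diagonals (2 * k + 4) k \<Longrightarrow> column_diagonal k (diagonal_column k d) = d"
proof -
  let ?R = "relevant_diagonals (2 * k + 4) k"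
  have cd: "column_diagonal k j \<in> ?R" if "j < 3 * k + 6" for j
  proof (cases j rule: mod3_cases)
    case (1 i)
    then show ?thesis using that k unfolding 1 column_diagonal_simps by (auto simp: relevant_iff[OF k])
  next
    case (2 i)
    then show ?thesis using that k unfolding 2 column_diagonal_simps by (auto simp: relevant_iff[OF k])
  next
    case (3 i)
    then show ?thesis using that k unfolding 3 column_diagonal_simps by (auto simp: relevant_iff[OF k])
  qed
  have dc: "diagonal_column k (column_diagonal k j) = j" if "j < 3 * k + 6" for j
  proof (cases j rule: mod3_cases)
    case (1 i)
    then show ?thesis
      using cd[OF that] unfolding 1 column_diagonal_simps by (simp add: diagonal_column_eq[OF k])
  next
    case (2 i)
    then show ?thesis
      using cd[OF that] unfolding 2 column_diagonal_simps
      by (cases "i = k + 1") (simp_all add: diagonal_column_eq[OF k])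
  next
    case (3 i)
    then show ?thesis
      using cd[OF that] unfolding 3 column_diagonal_simps by (simp add: diagonal_column_eq[OF k])
  qed
  have lt: "diagonal_column k d < 3 * k + 6 \<and> column_diagonal k (diagonal_column k d) = d" if "d \<in> ?R" for d
  proof -
    obtain a b where d: "d = (a, b)" by (cases d)
    with that have *: "(a, b) \<in> ?R" by simp
    then have "1 \<le> a" "b \<le> 2 * k + 4" by (simp_all add: relevant_iff[OF k])
    consider "a = 1" "b = a + k + 1" | "a \<ge> 2" "b = a + k + 1" | "b = a + k + 2" | "b = a + k + 3"
      using * \<open>1 \<le> a\<close> unfolding relevant_iff[OF k] by linarith
    then show ?thesis
    proof cases
      case 1
      then show ?thesis
        unfolding d diagonal_column_eq[OF k *] by (simp add: column_diagonal_simps(3)[of k "k + 1", simplified])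
    next
      case 2
      then obtain i where "a = i + 2" by (metis add.commute le_Suc_ex)
      then show ?thesis
        using 2 \<open>b \<le> _\<close> column_diagonal_simps(2)[of k i] unfolding d diagonal_column_eq[OF k *] by simp
    next
      case 3
      obtain i where "a = i + 1" using \<open>1 \<le> a\<close> by (metis add.commute le_Suc_ex)
      then show ?thesis
        using 3 \<open>b \<le> _\<close> column_diagonal_simps(1)[of k i] unfolding d diagonal_column_eq[OF k *] by simp
    next
      case 4
      obtain i where "a = i + 1" using \<open>1 \<le> a\<close> by (metis add.commute le_Suc_ex)
      then show ?thesis
        using 4 \<open>b \<le> _\<close> column_diagonal_simps(3)[of k i] unfolding d diagonal_column_eq[OF k *] by simp
    qed
  qed
  show "bij_betw (diagonal_column k) ?R {..<3 * k + 6}"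
    by (rule bij_betw_byWitness[where f' = "column_diagonal k"]) (use cd dc lt in auto)
  show "j < 3 * k + 6 \<Longrightarrow> column_diagonal k j \<in> ?R" "j < 3 * k + 6 \<Longrightarrow> diagonal_column k (column_diagonal k j) = j"
    "d \<in> ?R \<Longrightarrow> column_diagonal k (diagonal_column k d) = d"
    using cd dc lt by auto
qed

text \<open>The \<open>i\<close>-th vertex, starting from \<open>i = 0\<close>, of the polygon without its vertices \<open>x < y\<close>.\<close>

definition omitting :: "nat \<Rightarrow> nat \<Rightarrow> nat \<Rightarrow> nat" where
  "omitting x y i = (if i + 1 < x then i + 1 else if i + 2 < y then i + 2 else i + 3)"

text \<open>Joining opposite vertices of the remaining \<open>(2 * k + 2)\<close>-gon is the only
  way to get \<open>k + 1\<close> pairwise crossing diagonals in it.\<close>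

definition omitting_crossing :: "nat \<Rightarrow> nat \<Rightarrow> nat \<Rightarrow> (nat \<times> nat) set" where
  "omitting_crossing k x y = (\<lambda>i. (omitting x y i, omitting x y (i + k + 1))) ` {..k}"

lemma omitting_less: "i < j \<Longrightarrow> omitting x y i < omitting x y j"
  by (auto simp: omitting_def)

lemma is_crossing_omitting:
  assumes "k \<ge> 1"
  shows "is_crossing (2 * k + 4) (k + 1) (omitting_crossing k x y)"
  unfolding is_crossing_def
proof (intro conjI)
  show "omitting_crossing k x y \<subseteq> diagonals (2 * k + 4)"
  proof
    fix d assume "d \<in> omitting_crossing k x y"
    then obtain i where i: "i \<le> k" "d = (omitting x y i, omitting x y (i + k + 1))"
      by (auto simp: omitting_crossing_def)
    have "1 \<le> omitting x y i" "omitting x y i + k + 1 \<le> omitting x y (i + k + 1)"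
      "omitting x y (i + k + 1) \<le> omitting x y i + k + 3" "omitting x y (i + k + 1) \<le> i + k + 4"
      by (auto simp: omitting_def)
    then show "d \<in> diagonals (2 * k + 4)"
      unfolding i(2) diagonals_def using i(1) assms by auto
  qed
  have cr: "crosses (omitting x y i, omitting x y (i + k + 1)) (omitting x y j, omitting x y (j + k + 1))"
    if "i < j" "j \<le> k" for i j
    using that by (auto simp: crosses_simp intro!: omitting_less)
  have "inj_on (\<lambda>i. (omitting x y i, omitting x y (i + k + 1))) {..k}"
    by (rule inj_onI) (metis (no_types, lifting) Pair_inject less_irrefl linorder_neqE_nat omitting_less)
  then show "card (omitting_crossing k x y) = k + 1"
    by (simp add: omitting_crossing_def card_image)
  show "pairwise crosses (omitting_crossing k x y)"
    unfolding omitting_crossing_def pairwise_def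
  proof (intro ballI impI, elim imageE)
    fix d e i j
    assume de: "d \<noteq> e" "d = (omitting x y i, omitting x y (i + k + 1))" "i \<in> {..k}"
      "e = (omitting x y j, omitting x y (j + k + 1))" "j \<in> {..k}"
    then have "i \<noteq> j" by auto
    then have "i < j \<or> j < i" by linarith
    then show "crosses d e"
      using cr[of i j] cr[of j i] de by (auto simp: crosses_simp)
  qed
qed

section \<open>Letter patterns that contain a crossing\<close>

definition crossing_within :: "nat \<Rightarrow> nat set \<Rightarrow> bool" where
  "crossing_within k X \<longleftrightarrow> (\<exists>K. is_crossing (2 * k + 4) (k + 1) K \<and> diagonal_column k ` K \<subseteq> X)"

lemma crossing_withinI:
  assumes k: "k \<ge> 1" and "\<And>i. i \<le> k \<Longrightarrow> diagonal_column k (omitting x y i, omitting x y (i + k + 1)) \<in> X"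
  shows "crossing_within k X"
  unfolding crossing_within_def
  using is_crossing_omitting[OF k, of x y] assms(2)
  by (intro exI[of _ "omitting_crossing k x y"]) (auto simp: omitting_crossing_def)

lemma diagonal_column_simps:
  assumes k: "k \<ge> 1"
  shows "i \<le> k + 1 \<Longrightarrow> diagonal_column k (i + 1, i + k + 3) = 3 * i"
    and "i \<le> k \<Longrightarrow> diagonal_column k (i + 1, i + k + 4) = 3 * i + 1"
    and "diagonal_column k (1, k + 2) = 3 * (k + 1) + 1"
    and "i \<le> k + 1 \<Longrightarrow> diagonal_column k (i + 2, i + k + 3) = 3 * i + 2"
    and "i \<le> k \<Longrightarrow> diagonal_column k (i + 2, i + k + 4) = 3 * (i + 1)"
    and "i \<le> k \<Longrightarrow> diagonal_column k (i + 3, i + k + 4) = 3 * (i + 1) + 2"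
  using k by (simp_all add: diagonal_column_eq relevant_iff)

text \<open>With both omitted vertices in the first half, the second endpoint is always
  \<open>i + k + 4\<close> while the first jumps at \<open>x\<close> and \<open>y\<close>. The
  lengths \<open>k + 3\<close>, \<open>k + 2\<close>, \<open>k + 1\<close> give the letters 1, 0, 2
  in this order.\<close>

lemma crossing_within_A12:
  fixes x y :: nat
  assumes k: "k \<ge> 1" and xy: "1 \<le> x" "x < y" "y \<le> k + 2"
    and 1: "\<And>i. i + 2 \<le> x \<Longrightarrow> 3 * i + 1 \<in> X"
    and 0: "\<And>i. x \<le> i \<Longrightarrow> i + 2 \<le> y \<Longrightarrow> 3 * i \<in> X"
    and 2: "\<And>i. y \<le> i + 1 \<Longrightarrow> i \<le> k + 1 \<Longrightarrow> 3 * i + 2 \<in> X"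
  shows "crossing_within k X"
proof (rule crossing_withinI[OF k, of x y])
  fix i assume "i \<le> k"
  have b: "omitting x y (i + k + 1) = i + k + 4" using xy by (auto simp: omitting_def)
  consider "i + 1 < x" | "x \<le> i + 1" "i + 2 < y" | "y \<le> i + 2" by linarith
  then show "diagonal_column k (omitting x y i, omitting x y (i + k + 1)) \<in> X"
  proof cases
    case 1
    then have "omitting x y i = i + 1" by (simp add: omitting_def)
    then show ?thesis using diagonal_column_simps(2)[OF k \<open>i \<le> k\<close>] assms(5)[of i] 1 b by simp
  next
    case 2
    then have "omitting x y i = i + 2" by (simp add: omitting_def)
    then show ?thesis unfolding b
      using diagonal_column_simps(5)[OF k \<open>i \<le> k\<close>] 0[of "i + 1"] 2 by simp
  next
    case 3
    then have "omitting x y i = i + 3" using xy by (simp add: omitting_def)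
    then show ?thesis unfolding b
      using diagonal_column_simps(6)[OF k \<open>i \<le> k\<close>] assms(7)[of "i + 1"] 3 \<open>i \<le> k\<close> by simp
  qed
qed

text \<open>With both omitted vertices in the second half the second endpoint jumps, so the lengths
  grow and the letters come in reverse order.\<close>

lemma crossing_within_A21:
  fixes x y :: nat
  assumes k: "k \<ge> 1" and xy: "1 \<le> x" "x < y" "y \<le> k + 2"
    and 2: "\<And>i. i + 2 \<le> x \<Longrightarrow> 3 * i + 2 \<in> X"
    and 0: "\<And>i. x \<le> i \<Longrightarrow> i + 2 \<le> y \<Longrightarrow> 3 * i \<in> X"
    and 1: "\<And>i. y \<le> i + 1 \<Longrightarrow> i \<le> k + 1 \<Longrightarrow> 3 * i + 1 \<in> X"
  shows "crossing_within k X"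
proof (rule crossing_withinI[OF k, of "x + k + 2" "y + k + 2"])
  let ?o = "omitting (x + k + 2) (y + k + 2)"
  fix i assume "i \<le> k"
  have a: "?o i = i + 1" using \<open>i \<le> k\<close> by (auto simp: omitting_def)
  consider "i = 0" | "i < x" "i \<noteq> 0" | "x \<le> i" "i + 1 < y" | "y \<le> i + 1" "i \<noteq> 0" by linarith
  then show "diagonal_column k (?o i, ?o (i + k + 1)) \<in> X"
  proof cases
    \<comment> \<open>This is the exceptional diagonal of length \<open>k + 1\<close>, carrying the
      letter 1 of the last block.\<close>
    case 1
    then have "?o (i + k + 1) = k + 2" using xy by (simp add: omitting_def)
    then show ?thesis using diagonal_column_simps(3)[OF k] assms(7)[of "k + 1"] 1 a xy by simp
  next
    case 2
    then obtain i' where i': "i = i' + 1" by (metis Suc_eq_plus1 not0_implies_Suc)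
    have "?o (i + k + 1) = i' + k + 3" using 2 i' by (simp add: omitting_def)
    then show ?thesis
      using diagonal_column_simps(4)[OF k, of i'] assms(5)[of i'] 2 a i' \<open>i \<le> k\<close> by simp
  next
    case 3
    then have "?o (i + k + 1) = i + k + 3" by (simp add: omitting_def)
    then show ?thesis
      using diagonal_column_simps(1)[OF k, of i] 0[of i] 3 a \<open>i \<le> k\<close> by simp
  next
    case 4
    then have "?o (i + k + 1) = i + k + 4" using xy by (simp add: omitting_def)
    then show ?thesis
      using diagonal_column_simps(2)[OF k, of i] assms(7)[of i] 4 a \<open>i \<le> k\<close> by simp
  qed
qed

text \<open>With one omitted vertex in each half, each endpoint jumps once. Between the jumps the
  length is \<open>k + 1\<close> if the first endpoint jumps earlier and \<open>k + 3\<close> if it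
  jumps later, giving letter 2 or 1; elsewhere it is \<open>k + 2\<close>, giving letter 0.\<close>

lemma crossing_within_B:
  fixes x y :: nat
  assumes k: "k \<ge> 1" and xy: "1 \<le> x" "x \<le> k + 2" "1 \<le> y" "y \<le> k + 2"
    and 0: "\<And>i. i + 2 \<le> x \<Longrightarrow> i + 2 \<le> y \<Longrightarrow> 3 * i \<in> X"
      "\<And>i. x \<le> i \<Longrightarrow> y \<le> i \<Longrightarrow> i \<le> k + 1 \<Longrightarrow> 3 * i \<in> X"
    and 2: "\<And>i. x \<le> i + 1 \<Longrightarrow> i + 2 \<le> y \<Longrightarrow> 3 * i + 2 \<in> X"
    and 1: "\<And>i. y \<le> i + 1 \<Longrightarrow> i + 2 \<le> x \<Longrightarrow> 3 * i + 1 \<in> X"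
  shows "crossing_within k X"
proof (rule crossing_withinI[OF k, of "x" "y + k + 2"])
  let ?o = "omitting x (y + k + 2)"
  fix i assume "i \<le> k"
  have a: "?o i = (if i + 2 \<le> x then i + 1 else i + 2)" using \<open>i \<le> k\<close> xy by (auto simp: omitting_def)
  have b: "?o (i + k + 1) = (if i + 2 \<le> y then i + k + 3 else i + k + 4)" using \<open>i \<le> k\<close> xy by (auto simp: omitting_def)
  consider "i + 2 \<le> x" "i + 2 \<le> y" | "i + 2 \<le> x" "y \<le> i + 1" | "x \<le> i + 1" "i + 2 \<le> y" | "x \<le> i + 1" "y \<le> i + 1" by linarith
  then show "diagonal_column k (?o i, ?o (i + k + 1)) \<in> X"
  proof cases
    case 1
    then show ?thesis unfolding a b using diagonal_column_simps(1)[OF k, of i] 0(1)[of i] \<open>i \<le> k\<close> by simp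
  next
    case 2
    then show ?thesis unfolding a b using diagonal_column_simps(2)[OF k, of i] 1[of i] \<open>i \<le> k\<close> by simp
  next
    case 3
    then show ?thesis unfolding a b using diagonal_column_simps(4)[OF k, of i] 2[of i] \<open>i \<le> k\<close> by simp
  next
    case 4
    then show ?thesis unfolding a b
      using diagonal_column_simps(5)[OF k \<open>i \<le> k\<close>] 0(2)[of "i + 1"] \<open>i \<le> k\<close> by simp
  qed
qed

lemma alternates_B_crossing:
  assumes k: "k \<ge> 1" and alt: "alternates_B (int (k + 2)) (\<lambda>i. 3 * nat i \<in> X) (\<lambda>i. 3 * nat i + s \<in> X)"
    and s: "s = 1 \<or> s = 2"
  shows "crossing_within k X"
proof -
  obtain x y :: int where xy: "x \<le> y"
    and *: "\<And>i. 0 \<le> i \<Longrightarrow> i < int (k + 2) \<Longrightarrow> i \<le> x - 2 \<Longrightarrow> 3 * nat i \<in> X"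
      "\<And>i. 0 \<le> i \<Longrightarrow> i < int (k + 2) \<Longrightarrow> x - 1 \<le> i \<Longrightarrow> i \<le> y - 2 \<Longrightarrow> 3 * nat i + s \<in> X"
      "\<And>i. 0 \<le> i \<Longrightarrow> i < int (k + 2) \<Longrightarrow> y \<le> i \<Longrightarrow> 3 * nat i \<in> X"
    using alt unfolding alternates_B_def by auto
  \<comment> \<open>Clamping to \<open>1..k + 2\<close> preserves \<open>x \<le> y\<close> and adds
    no condition on the blocks \<open>0..k + 1\<close>.\<close>
  define x' where "x' = nat (max 1 (min x (int (k + 2))))"
  define y' where "y' = nat (max 1 (min y (int (k + 2))))"
  have b: "1 \<le> x'" "x' \<le> k + 2" "1 \<le> y'" "y' \<le> k + 2" "x' \<le> y'"
    using xy by (auto simp: x'_def y'_def)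
  have 0: "3 * i \<in> X" if "i + 2 \<le> x'" for i
    using *(1)[of "int i"] that by (auto simp: x'_def)
  have 1: "3 * i + s \<in> X" if "x' \<le> i + 1" "i + 2 \<le> y'" for i
    using *(2)[of "int i"] that by (auto simp: x'_def y'_def)
  have 2: "3 * i \<in> X" if "y' \<le> i" "i \<le> k + 1" for i
    using *(3)[of "int i"] that by (auto simp: y'_def)
  show ?thesis
  proof (cases "s = 2")
    case True
    then show ?thesis using b 0 1 2 by (intro crossing_within_B[OF k, of x' y']) auto
  next
    case False
    then show ?thesis using b 0 1 2 s by (intro crossing_within_B[OF k, of y' x']) auto
  qed
qed

lemma alternates_A_crossing:
  assumes k: "k \<ge> 1" and alt: "alternates_A (int (k + 2)) (\<lambda>i. 3 * nat i + s \<in> X) (\<lambda>i. 3 * nat i \<in> X) (\<lambda>i. 3 * nat i + t \<in> X)"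
    and st: "s = 1 \<and> t = 2 \<or> s = 2 \<and> t = 1"
  shows "crossing_within k X"
proof -
  obtain x y :: int where xy: "x < y"
    and *: "\<And>i. 0 \<le> i \<Longrightarrow> i < int (k + 2) \<Longrightarrow> i \<le> x - 2 \<Longrightarrow> 3 * nat i + s \<in> X"
      "\<And>i. 0 \<le> i \<Longrightarrow> i < int (k + 2) \<Longrightarrow> x \<le> i \<Longrightarrow> i \<le> y - 2 \<Longrightarrow> 3 * nat i \<in> X"
      "\<And>i. 0 \<le> i \<Longrightarrow> i < int (k + 2) \<Longrightarrow> y - 1 \<le> i \<Longrightarrow> 3 * nat i + t \<in> X"
    using alt unfolding alternates_A_def by auto
  show ?thesis
  proof (cases "y \<le> int (k + 2)")
    case True
    define x' where "x' = nat (max 1 x)"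
    define y' where "y' = nat (max 2 y)"
    have b: "1 \<le> x'" "x' < y'" "y' \<le> k + 2"
      using xy True by (auto simp: x'_def y'_def)
    have 1: "3 * i + s \<in> X" if "i + 2 \<le> x'" for i
      using *(1)[of "int i"] that b by (auto simp: x'_def)
    have 0: "3 * i \<in> X" if "x' \<le> i" "i + 2 \<le> y'" for i
      using *(2)[of "int i"] that b by (auto simp: x'_def y'_def)
    have 2: "3 * i + t \<in> X" if "y' \<le> i + 1" "i \<le> k + 1" for i
      using *(3)[of "int i"] that by (auto simp: y'_def)
    show ?thesis
      using st b 0 1 2 crossing_within_A12[OF k, of x' y' X] crossing_within_A21[OF k, of x' y' X] by auto
  next
    case False
    \<comment> \<open>For \<open>y > k + 2\<close> the last stretch lies beyond all blocks; what
      remains, \<open>s\<close> followed by 0, is a B pattern whose first stretch is empty.\<close>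
    have "alternates_B (int (k + 2)) (\<lambda>i. 3 * nat i \<in> X) (\<lambda>i. 3 * nat i + s \<in> X)"
      unfolding alternates_B_def
    proof (intro exI conjI ballI)
      show "(1::int) \<le> max 1 (min x (int (k + 2)))" by simp
      fix i assume "i \<in> {0..<int (k + 2)}"
      then show "i \<le> 1 - 2 \<longrightarrow> 3 * nat i \<in> X"
        "1 - 1 \<le> i \<and> i \<le> max 1 (min x (int (k + 2))) - 2 \<longrightarrow> 3 * nat i + s \<in> X"
        "max 1 (min x (int (k + 2))) \<le> i \<longrightarrow> 3 * nat i \<in> X"
        using *(1)[of i] *(2)[of i] False by auto
    qed
    then show ?thesis using alternates_B_crossing[OF k] st by blast
  qed
qed

lemma alternation_crossing:
  assumes k: "k \<ge> 1" and alt: "alternation (int (k + 2)) (\<lambda>i. 3 * nat i \<in> X) (\<lambda>i. 3 * nat i + 1 \<in> X) (\<lambda>i. 3 * nat i + 2 \<in> X)"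
  shows "crossing_within k X"
  using alt alternates_A_crossing[OF k, of 1 X 2] alternates_A_crossing[OF k, of 2 X 1]
    alternates_B_crossing[OF k, of X 1] alternates_B_crossing[OF k, of X 2]
  unfolding alternation_def by blast

text \<open>Pairwise crossing diagonals share no endpoint, so \<open>K\<close> uses
  \<open>2 * k + 2\<close> vertices and leaves \<open>x\<close>, \<open>y\<close>. Each diagonal has
  \<open>k\<close> used vertices strictly between its ends, so its length is \<open>k + 1\<close>
  plus the number of omitted vertices it spans. Conversely this length determines the second
  endpoint, which gives a test for membership in \<open>K\<close>.\<close>

lemma crossing_omits_two_vertices:
  assumes "is_crossing (2 * k + 4) (k + 1) K"
  obtains x y where "1 \<le> x" "x < y" "y \<le> 2 * k + 4"
    "\<And>a b. 1 \<le> a \<Longrightarrow> a < b \<Longrightarrow> b \<le> 2 * k + 4 \<Longrightarrow> a \<notin> {x, y} \<Longrightarrow> b \<notin> {x, y} \<Longrightarrow>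
      b = a + k + 1 + of_bool (a < x \<and> x < b) + of_bool (a < y \<and> y < b) \<Longrightarrow> (a, b) \<in> K"
proof -
  let ?l = "2 * k + 4"
  have K: "K \<subseteq> diagonals ?l" "card K = k + 1" and pw: "pairwise crosses K"
    using assms by (auto simp: is_crossing_def)
  have fin: "finite K" using K(2) by (intro card_ge_0_finite) simp
  have range: "1 \<le> a" "a < b" "b \<le> ?l" if "(a, b) \<in> K" for a b
    using that K(1) by (auto simp: diagonals_def)
  have cr: "a < c \<and> c < b \<and> b < d \<or> c < a \<and> a < d \<and> d < b" if "(a, b) \<in> K" "(c, d) \<in> K" "(a, b) \<noteq> (c, d)" for a b c d
    using pw that unfolding pairwise_def crosses_simp[symmetric] by blast
  define W where "W = fst ` K \<union> snd ` K"
  have "inj_on fst K" "inj_on snd K"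
    by (rule inj_onI, use cr in fastforce)+
  moreover have "fst ` K \<inter> snd ` K = {}"
  proof -
    have "a \<noteq> d" if "(a, b) \<in> K" "(c, d) \<in> K" for a b c d
      using cr[OF that] range[OF that(1)] by (cases "(a, b) = (c, d)") auto
    then show ?thesis by force
  qed
  ultimately have "card W = 2 * k + 2"
    unfolding W_def using fin K(2) by (subst card_Un_disjoint) (auto simp: card_image)
  moreover have W: "W \<subseteq> {1..?l}" using range by (fastforce simp: W_def)
  ultimately have "card ({1..?l} - W) = 2" by (subst card_Diff_subset) (auto intro: finite_subset)
  then obtain u v where uv: "{1..?l} - W = {u, v}" "u \<noteq> v" unfolding card_2_iff by blast
  have "u < v \<or> v < u \<and> {1..?l} - W = {v, u}"
    using uv(2) unfolding uv(1) doubleton_eq_iff by linarith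
  with uv(1) obtain x y where xy: "{1..?l} - W = {x, y}" "x < y" by blast
  then have mem: "x \<in> {1..?l} - W" "y \<in> {1..?l} - W" by auto
  have inW: "w \<in> W \<longleftrightarrow> w \<notin> {x, y}" if "1 \<le> w" "w \<le> ?l" for w
  proof -
    have "w \<in> {1..?l} - W \<longleftrightarrow> w \<in> {x, y}" by (simp only: xy(1))
    then show ?thesis using that unfolding Diff_iff atLeastAtMost_iff by blast
  qed
  have len: "b = a + k + 1 + of_bool (a < x \<and> x < b) + of_bool (a < y \<and> y < b)" if ab: "(a, b) \<in> K" for a b
  proof -
    let ?in = "\<lambda>(c, d). if a < c \<and> c < b then c else d :: nat"
    \<comment> \<open>Every other diagonal of \<open>K\<close> has exactly one endpoint strictly
      between \<open>a\<close> and \<open>b\<close>.\<close>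
    have "bij_betw ?in (K - {(a, b)}) (W \<inter> {a<..<b})"
    proof (rule bij_betwI')
      fix p q assume "p \<in> K - {(a, b)}" "q \<in> K - {(a, b)}"
      then show "?in p = ?in q \<longleftrightarrow> p = q"
        using cr[of "fst p" "snd p" "fst q" "snd q"] range[of "fst p" "snd p"] range[of "fst q" "snd q"]
        by (cases p; cases q) (auto split: if_splits)
    next
      fix p assume p: "p \<in> K - {(a, b)}"
      obtain c d where cd: "p = (c, d)" by (cases p)
      then have "c \<in> W" "d \<in> W" using p by (force simp: W_def)+
      then show "?in p \<in> W \<inter> {a<..<b}"
        using cr[OF ab, of c d] p cd by auto
    next
      fix w assume w: "w \<in> W \<inter> {a<..<b}"
      then obtain c d where cd: "(c, d) \<in> K" "w = c \<or> w = d" by (auto simp: W_def)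
      then have "(c, d) \<in> K - {(a, b)}" using w by auto
      moreover have "?in (c, d) = w" using cr[OF ab cd(1)] w cd(2) calculation by auto
      ultimately show "\<exists>p\<in>K - {(a, b)}. w = ?in p" by metis
    qed
    then have c: "card (W \<inter> {a<..<b}) = k"
      using bij_betw_same_card K(2) ab fin by fastforce
    have "{a<..<b} = (W \<inter> {a<..<b}) \<union> ({x, y} \<inter> {a<..<b})"
      using inW range[OF ab] by auto
    moreover have "(W \<inter> {a<..<b}) \<inter> ({x, y} \<inter> {a<..<b}) = {}" using mem by auto
    ultimately have "card {a<..<b} = card (W \<inter> {a<..<b}) + card ({x, y} \<inter> {a<..<b})"
      by (metis card_Un_disjoint finite_Int finite_greaterThanLessThan)
    moreover have "card ({x, y} \<inter> {a<..<b}) = of_bool (a < x \<and> x < b) + of_bool (a < y \<and> y < b)"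
      using xy(2) by (auto simp: Int_insert_left)
    ultimately show ?thesis using c range[OF ab] by simp
  qed
  have add: "of_bool (p < z \<and> z < q) + of_bool (q < z \<and> z < r) = (of_bool (p < z \<and> z < r) :: nat)"
    if "p < q" "q < r" "q \<noteq> z" for p q r z :: nat
    using that by (auto simp: of_bool_def)
  show thesis
  proof (rule that[of x y])
    show "1 \<le> x" "x < y" "y \<le> ?l" using mem xy(2) by auto
    fix a b
    assume ab: "1 \<le> a" "a < b" "b \<le> ?l" "a \<notin> {x, y}" "b \<notin> {x, y}"
      "b = a + k + 1 + of_bool (a < x \<and> x < b) + of_bool (a < y \<and> y < b)"
    then have "a \<in> W" using inW[of a] by auto
    then consider b' where "(a, b') \<in> K" | a' where "(a', a) \<in> K" by (auto simp: W_def)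
    then show "(a, b) \<in> K"
    proof cases
      case (1 b')
      have "b' \<in> W" using 1 by (force simp: W_def)
      then have "b' \<noteq> x" "b' \<noteq> y" using mem by auto
      \<comment> \<open>Two solutions \<open>p < q\<close> of the length equation would differ by
        the number of omitted vertices strictly between them, which is less than
        \<open>q - p\<close>.\<close>
      have "\<not> p < q" if "a < p" "p \<noteq> x" "p \<noteq> y" "q \<noteq> x" "q \<noteq> y"
        "p = a + k + 1 + of_bool (a < x \<and> x < p) + of_bool (a < y \<and> y < p)"
        "q = a + k + 1 + of_bool (a < x \<and> x < q) + of_bool (a < y \<and> y < q)" for p q
      proof
        assume "p < q"
        have "q = p + of_bool (p < x \<and> x < q) + of_bool (p < y \<and> y < q)"
          using that(6,7) add[OF \<open>a < p\<close> \<open>p < q\<close> that(2)] add[OF \<open>a < p\<close> \<open>p < q\<close> that(3)] by linarith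
        then show False
          using \<open>p < q\<close> xy(2) by (cases "p < x \<and> x < q"; cases "p < y \<and> y < q") simp_all
      qed
      from this[of b b'] this[of b' b] have "b = b'"
        using len[OF 1] range[OF 1] ab \<open>b' \<noteq> x\<close> \<open>b' \<noteq> y\<close> by (metis insertCI linorder_neqE_nat)
      then show ?thesis using 1 by simp
    next
      case (2 a')
      have "a' \<in> W" using 2 by (force simp: W_def)
      then have "a' \<noteq> x" "a' \<noteq> y" using mem by auto
      \<comment> \<open>From \<open>a'\<close> to \<open>b\<close> inclusive there would be
        \<open>2 * k + 3\<close> vertices other than \<open>x\<close> and \<open>y\<close>, one more
        than the polygon has.\<close>
      define X :: nat where "X = of_bool (a' < x \<and> x < b)"
      define Y :: nat where "Y = of_bool (a' < y \<and> y < b)"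
      have "b = a' + 2 * k + 2 + X + Y"
        using len[OF 2] ab(4,6) add[OF range(2)[OF 2] ab(2), of x] add[OF range(2)[OF 2] ab(2), of y]
        by (simp add: X_def Y_def)
      moreover have "1 \<le> a'" "1 \<le> x" "y \<le> ?l" using range[OF 2] mem by auto
      moreover have "x < a' \<and> X = 0 \<or> b < x \<and> X = 0 \<or> X = 1"
        using ab(5) \<open>a' \<noteq> x\<close> by (auto simp: X_def)
      moreover have "y < a' \<and> Y = 0 \<or> b < y \<and> Y = 0 \<or> Y = 1"
        using ab(5) \<open>a' \<noteq> y\<close> by (auto simp: Y_def)
      ultimately have False using ab(3) xy(2) by (elim disjE conjE; linarith)
      then show ?thesis ..
    qed
  qed
qed

text \<open>In column order a crossing is cut out by two thresholds, with one letter before, one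
  between and one after them. If \<open>B\<close> has these three letters in order, the first misses
  \<open>K\<close> only past the first threshold, the second then only past the second one, and the
  third is caught.\<close>

lemma crossing_meets_longest_subword:
  assumes k: "k \<ge> 1" and K: "is_crossing (2 * k + 4) (k + 1) K" and B: "B \<in> longest_subwords (3 * k + 6)"
  shows "\<exists>j\<in>B. column_diagonal k j \<in> K"
proof -
  obtain x y where xy: "1 \<le> x" "x < y" "y \<le> 2 * k + 4"
    and mem: "\<And>a b. 1 \<le> a \<Longrightarrow> a < b \<Longrightarrow> b \<le> 2 * k + 4 \<Longrightarrow> a \<notin> {x, y} \<Longrightarrow> b \<notin> {x, y} \<Longrightarrow>
      b = a + k + 1 + of_bool (a < x \<and> x < b) + of_bool (a < y \<and> y < b) \<Longrightarrow> (a, b) \<in> K"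
    using crossing_omits_two_vertices[OF K] by blast
  have dm: "j = 3 * (j div 3) + j mod 3" for j :: nat by simp
  note cd = column_diagonal_simps[of k]
  consider (A12) "y \<le> k + 2" | (A21) "k + 2 < x" | (B2) y' where "x \<le> k + 2" "y = y' + k + 2" "1 \<le> y'" "x \<le> y'"
    | (B1) y' where "x \<le> k + 2" "y = y' + k + 2" "1 \<le> y'" "y' < x"
  proof -
    have "y \<le> k + 2 \<or> k + 2 < x \<or> x \<le> k + 2 \<and> y = (y - (k + 2)) + k + 2 \<and> 1 \<le> y - (k + 2)" by linarith
    then show thesis using that by (meson linorder_not_le)
  qed
  then show ?thesis
  proof cases
    case A12
    obtain j1 j2 j3 where j: "j1 \<in> B" "j2 \<in> B" "j3 \<in> B" "j1 < j2" "j2 < j3" "j3 < 3 * k + 6"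
      "j1 mod 3 = 1" "j2 mod 3 = 0" "j3 mod 3 = 2"
      using longest_subwords_subsequence[OF B, of 1 0 2] by auto
    define i1 i2 i3 where i: "i1 = j1 div 3" "i2 = j2 div 3" "i3 = j3 div 3"
    have ji: "j1 = 3 * i1 + 1" "j2 = 3 * i2" "j3 = 3 * i3 + 2" using dm[of j1] dm[of j2] dm[of j3] j i by auto
    \<comment> \<open>Within a block the letters come as 0, 1, 2: a 0 after a 1 is in a later block,
      while a 2 after a 0 may share its block. The gaps of the pattern match this.\<close>
    have le: "i1 < i2" "i2 \<le> i3" "i3 \<le> k + 1" using j unfolding ji by auto
    consider "i1 + 2 \<le> x" | "x \<le> i2" "i2 + 2 \<le> y" | "y \<le> i3 + 1" using le by linarith
    then show ?thesis
    proof cases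
      case 1
      then have "column_diagonal k j1 \<in> K" unfolding ji cd using A12 xy by (auto intro!: mem)
      then show ?thesis using j by blast
    next
      case 2
      then have "column_diagonal k j2 \<in> K" unfolding ji cd using A12 xy le by (auto intro!: mem)
      then show ?thesis using j by blast
    next
      case 3
      then have "column_diagonal k j3 \<in> K" unfolding ji cd using A12 xy le by (auto intro!: mem)
      then show ?thesis using j by blast
    qed
  next
    case A21
    obtain j1 j2 j3 where j: "j1 \<in> B" "j2 \<in> B" "j3 \<in> B" "j1 < j2" "j2 < j3" "j3 < 3 * k + 6"
      "j1 mod 3 = 2" "j2 mod 3 = 0" "j3 mod 3 = 1"
      using longest_subwords_subsequence[OF B, of 2 0 1] by auto
    define i1 i2 i3 where i: "i1 = j1 div 3" "i2 = j2 div 3" "i3 = j3 div 3"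
    have ji: "j1 = 3 * i1 + 2" "j2 = 3 * i2" "j3 = 3 * i3 + 1" using dm[of j1] dm[of j2] dm[of j3] j i by auto
    have le: "i1 < i2" "i2 \<le> i3" "i3 \<le> k + 1" using j unfolding ji by auto
    consider "i1 + k + 4 \<le> x" | "x \<le> i2 + k + 2" "i2 + k + 4 \<le> y" | "y \<le> i3 + k + 3" using le by linarith
    then show ?thesis
    proof cases
      case 1
      then have "column_diagonal k j1 \<in> K" unfolding ji cd using A21 xy le by (auto intro!: mem)
      then show ?thesis using j by blast
    next
      case 2
      then have "column_diagonal k j2 \<in> K" unfolding ji cd using A21 xy le by (auto intro!: mem)
      then show ?thesis using j by blast
    next
      case 3
      then have "column_diagonal k j3 \<in> K" unfolding ji cd using A21 xy le by (auto intro!: mem)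
      then show ?thesis using j by blast
    qed
  next
    case (B2 y')
    obtain j1 j2 j3 where j: "j1 \<in> B" "j2 \<in> B" "j3 \<in> B" "j1 < j2" "j2 < j3" "j3 < 3 * k + 6"
      "j1 mod 3 = 0" "j2 mod 3 = 2" "j3 mod 3 = 0"
      using longest_subwords_subsequence[OF B, of 0 2 0] by auto
    define i1 i2 i3 where i: "i1 = j1 div 3" "i2 = j2 div 3" "i3 = j3 div 3"
    have ji: "j1 = 3 * i1" "j2 = 3 * i2 + 2" "j3 = 3 * i3" using dm[of j1] dm[of j2] dm[of j3] j i by auto
    have le: "i1 \<le> i2" "i2 < i3" "i3 \<le> k + 1" using j unfolding ji by auto
    consider "i1 + 2 \<le> x" | "x \<le> i2 + 1" "i2 + 2 \<le> y'" | "y' \<le> i3" using le by linarith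
    then show ?thesis
    proof cases
      case 1
      then have "column_diagonal k j1 \<in> K" unfolding ji cd using B2 xy le by (auto intro!: mem)
      then show ?thesis using j by blast
    next
      case 2
      then have "column_diagonal k j2 \<in> K" unfolding ji cd using B2 xy le by (auto intro!: mem)
      then show ?thesis using j by blast
    next
      case 3
      then have "column_diagonal k j3 \<in> K" unfolding ji cd using B2 xy le by (auto intro!: mem)
      then show ?thesis using j by blast
    qed
  next
    case (B1 y')
    obtain j1 j2 j3 where j: "j1 \<in> B" "j2 \<in> B" "j3 \<in> B" "j1 < j2" "j2 < j3" "j3 < 3 * k + 6"
      "j1 mod 3 = 0" "j2 mod 3 = 1" "j3 mod 3 = 0"
      using longest_subwords_subsequence[OF B, of 0 1 0] by auto
    define i1 i2 i3 where i: "i1 = j1 div 3" "i2 = j2 div 3" "i3 = j3 div 3"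
    have ji: "j1 = 3 * i1" "j2 = 3 * i2 + 1" "j3 = 3 * i3" using dm[of j1] dm[of j2] dm[of j3] j i by auto
    have le: "i1 \<le> i2" "i2 < i3" "i3 \<le> k + 1" using j unfolding ji by auto
    consider "i1 + 2 \<le> y'" | "y' \<le> i2 + 1" "i2 + 2 \<le> x" | "x \<le> i3" using le by linarith
    then show ?thesis
    proof cases
      case 1
      then have "column_diagonal k j1 \<in> K" unfolding ji cd using B1 xy le by (auto intro!: mem)
      then show ?thesis using j by blast
    next
      case 2
      then have "column_diagonal k j2 \<in> K" unfolding ji cd using B1 xy le by (auto intro!: mem)
      then show ?thesis using j by blast
    next
      case 3
      then have "column_diagonal k j3 \<in> K" unfolding ji cd using B1 xy le by (auto intro!: mem)
      then show ?thesis using j by blast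
    qed
  qed
qed


section \<open>The Gale dual and the fan\<close>

text \<open>At \<open>s = 0\<close> and \<open>s = - 1\<close> the value of \<open>gale s t\<close> is a unit vector, so that \<open>gale_column\<close> is a Gale dual of all the columns of \<^term>\<open>M213 (k + 2)\<close>, including the last six.\<close>

definition gale :: "real \<Rightarrow> nat \<Rightarrow> real \<times> real \<times> real \<times> real \<times> real \<times> real" where
  "gale s t = (B213 s $$ (0, t), B213 s $$ (1, t), B213 s $$ (2, t), B213 s $$ (3, t), B213 s $$ (4, t), B213 s $$ (5, t))"

lemma gale_simps:
  "gale s 0 = ((s + 1)\<^sup>2, s * (s + 1), s * (s + 1), 1 - (s + 1)\<^sup>2, - (s * (s + 1)), - (s * (s + 1)))"
  "gale s 1 = (- (s * (s + 1) / 2), 1 - (s - 1) * s / 2, - (s * (s + 1) / 2),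
     s * (s + 1) / 2, (s - 1) * s / 2, s * (s + 1) / 2)"
  "gale s 2 = (- (s * (s + 1) / 2), - (s * (s + 1) / 2), 1 - (s - 1) * s / 2,
     s * (s + 1) / 2, s * (s + 1) / 2, (s - 1) * s / 2)"
  by (simp_all add: gale_def B213_def mat_of_rows_list_def S213_def T213_def)

definition gale_column :: "nat \<Rightarrow> nat \<Rightarrow> real \<times> real \<times> real \<times> real \<times> real \<times> real" where
  "gale_column k j = gale (real k - real (j div 3)) (j mod 3)"

lemma gale_sign_crossing:
  assumes k: "k \<ge> 1" and "y \<noteq> 0"
  shows "crossing_within k {j. inner (gale_column k j) y > 0} \<or>
    crossing_within k {j. inner (gale_column k j) y < 0}"
proof -
  obtain y1 y2 y3 y4 y5 y6 where y: "y = (y1, y2, y3, y4, y5, y6)" by (cases y) auto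
  \<comment> \<open>In terms of the time \<open>t = i\<close> for \<open>s\<^sub>2\<close> and \<open>t = i + 1/2\<close> for \<open>s\<^sub>1, s\<^sub>3\<close>, where the quadratics along the three
    letters add up to a constant.\<close>
  define D where "D = y1 - y4"
  define \<sigma> where "\<sigma> = D + (y2 + y3 - y5 - y6)"
  define e1 where "e1 = (- y1 + y2 - y3 + y4 - y5 + y6) / 2"
  define e2 where "e2 = (- y1 - y2 + y3 + y4 + y5 - y6) / 2"
  \<comment> \<open>With \<open>s = k - i\<close> the inner products are
    \<open>\<sigma> * s^2 + (\<sigma> + D) * s + y1\<close>,
    \<open>- (\<sigma>/2) * s^2 + e1 * s + y2\<close> and
    \<open>- (\<sigma>/2) * s^2 + e2 * s + y3\<close>. The remaining constants are their
    coefficients after substituting \<open>s = k - t\<close> in the first and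
    \<open>s = \<kappa> - t\<close> in the others.\<close>
  define \<kappa> where "\<kappa> = real k + 1/2"
  define \<beta> where "\<beta> = - 2 * real k * \<sigma> - (\<sigma> + D)"
  define \<gamma> where "\<gamma> = \<sigma> * (real k)\<^sup>2 + (\<sigma> + D) * real k + y1"
  define b1 where "b1 = \<sigma> * \<kappa> - e1"
  define b2 where "b2 = \<sigma> * \<kappa> - e2"
  define c1 where "c1 = - (\<sigma>/2) * \<kappa>\<^sup>2 + e1 * \<kappa> + y2"
  define c2 where "c2 = - (\<sigma>/2) * \<kappa>\<^sup>2 + e2 * \<kappa> + y3"
  note defs = D_def \<sigma>_def e1_def e2_def \<kappa>_def \<beta>_def \<gamma>_def b1_def b2_def c1_def c2_def
  have col: "gale_column k (3 * i) = gale (real k - real i) 0"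
    "gale_column k (3 * i + 1) = gale (real k - real i) 1"
    "gale_column k (3 * i + 2) = gale (real k - real i) 2" for i
  proof -
    have "(3 * i + 2) div 3 = i" "(3 * i + 2) mod 3 = 2" "(3 * i + 1) div 3 = i" "(3 * i + 1) mod 3 = 1"
      by presburger+
    then show "gale_column k (3 * i) = gale (real k - real i) 0"
      "gale_column k (3 * i + 1) = gale (real k - real i) 1"
      "gale_column k (3 * i + 2) = gale (real k - real i) 2"
      unfolding gale_column_def by simp_all
  qed
  have f: "inner (gale_column k (3 * i)) y = \<sigma> * (real i)\<^sup>2 + \<beta> * real i + \<gamma>"
    "inner (gale_column k (3 * i + 1)) y = - (\<sigma>/2) * (real i + 1/2)\<^sup>2 + b1 * (real i + 1/2) + c1"
    "inner (gale_column k (3 * i + 2)) y = - (\<sigma>/2) * (real i + 1/2)\<^sup>2 + b2 * (real i + 1/2) + c2" for i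
    unfolding col gale_simps y inner_Pair inner_real_def defs by (simp_all add: field_simps power2_eq_square)
  have "one_signed (int (k + 2)) (\<lambda>t. \<sigma> * t\<^sup>2 + \<beta> * t + \<gamma>) (\<lambda>t. - (\<sigma>/2) * t\<^sup>2 + b1 * t + c1)
    (\<lambda>t. - (\<sigma>/2) * t\<^sup>2 + b2 * t + c2)"
  proof (rule one_signed_quadratics)
    show "b1 + b2 = - \<beta>" unfolding defs by (simp add: field_simps)
    show "\<not> (\<sigma> = 0 \<and> \<beta> = 0 \<and> \<gamma> = 0 \<and> b1 = 0 \<and> c1 = 0 \<and> c2 = 0)"
    proof
      assume z: "\<sigma> = 0 \<and> \<beta> = 0 \<and> \<gamma> = 0 \<and> b1 = 0 \<and> c1 = 0 \<and> c2 = 0"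
      then have "\<sigma> = 0" "D = 0" "e1 = 0" "y1 = 0" by (auto simp: \<beta>_def b1_def \<gamma>_def)
      moreover have "e1 + e2 = - D" by (simp add: e1_def e2_def D_def field_simps)
      ultimately have "e2 = 0" by simp
      have "y2 = 0" "y3 = 0" using z \<open>e1 = 0\<close> \<open>e2 = 0\<close> by (auto simp: c1_def c2_def)
      have "y4 = 0" using \<open>D = 0\<close> \<open>y1 = 0\<close> by (simp add: D_def)
      then have "y5 = 0" "y6 = 0"
        using \<open>\<sigma> = 0\<close> \<open>D = 0\<close> \<open>e1 = 0\<close> \<open>y1 = 0\<close> \<open>y2 = 0\<close> \<open>y3 = 0\<close> by (auto simp: \<sigma>_def e1_def)
      then show False using \<open>y \<noteq> 0\<close> \<open>y1 = 0\<close> \<open>y2 = 0\<close> \<open>y3 = 0\<close> \<open>y4 = 0\<close> by (simp add: y zero_prod_def)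
    qed
  qed
  then show ?thesis unfolding one_signed_def
  proof (elim disjE)
    assume "alternation (int (k + 2)) (\<lambda>i. 0 < \<sigma> * (real_of_int i)\<^sup>2 + \<beta> * real_of_int i + \<gamma>)
      (\<lambda>i. 0 < - (\<sigma> / 2) * (real_of_int i + 1 / 2)\<^sup>2 + b1 * (real_of_int i + 1 / 2) + c1)
      (\<lambda>i. 0 < - (\<sigma> / 2) * (real_of_int i + 1 / 2)\<^sup>2 + b2 * (real_of_int i + 1 / 2) + c2)"
    then have "crossing_within k {j. inner (gale_column k j) y > 0}"
      by (intro alternation_crossing[OF k], elim alternation_mono) (simp_all only: mem_Collect_eq f of_nat_nat)
    then show ?thesis ..
  next
    assume "alternation (int (k + 2)) (\<lambda>i. \<sigma> * (real_of_int i)\<^sup>2 + \<beta> * real_of_int i + \<gamma> < 0)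
      (\<lambda>i. - (\<sigma> / 2) * (real_of_int i + 1 / 2)\<^sup>2 + b1 * (real_of_int i + 1 / 2) + c1 < 0)
      (\<lambda>i. - (\<sigma> / 2) * (real_of_int i + 1 / 2)\<^sup>2 + b2 * (real_of_int i + 1 / 2) + c2 < 0)"
    then have "crossing_within k {j. inner (gale_column k j) y < 0}"
      by (intro alternation_crossing[OF k], elim alternation_mono) (simp_all only: mem_Collect_eq f of_nat_nat)
    then show ?thesis ..
  qed
qed

text \<open>A nonzero \<open>y\<close> is strictly one-signed on a crossing, and this crossing meets
  both \<open>B\<close> and \<open>B'\<close>; that is the separation needed for
  \<open>gale_dual_completeness\<close>.\<close>

lemma gale_dual_complete:
  fixes c :: "nat \<Rightarrow> real"
  assumes k: "k \<ge> 1"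
  shows "\<exists>y. \<exists>B\<in>longest_subwords (3 * k + 6). (\<forall>j<3 * k + 6. c j + inner (gale_column k j) y \<ge> 0) \<and>
    (\<forall>j\<in>B. c j + inner (gale_column k j) y = 0)"
proof -
  let ?\<B> = "longest_subwords (3 * k + 6)"
  have "\<exists>y. \<exists>B\<in>?\<B>. (\<forall>j\<in>{..<3 * k + 6}. c j + inner (gale_column k j) y \<ge> 0) \<and>
    (\<forall>j\<in>B. c j + inner (gale_column k j) y = 0)"
  proof (rule gale_dual_completeness)
    show "?\<B> \<noteq> {}" by (rule longest_subwords_nonempty) simp
    show "B \<subseteq> {..<3 * k + 6}" if "B \<in> ?\<B>" for B using that by (simp add: longest_subwords_def)
    show "card B = DIM(real \<times> real \<times> real \<times> real \<times> real \<times> real)" if "B \<in> ?\<B>" for B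
      using longest_subwords_length(3)[OF that] by simp
    show "\<exists>e'\<in>B. insert e (B - {e'}) \<in> ?\<B>" if "B \<in> ?\<B>" "e \<in> {..<3 * k + 6} - B" for B e
      using longest_subwords_exchange that by blast
    fix B B' y
    assume B: "B \<in> ?\<B>" "B' \<in> ?\<B>" and le: "\<And>e. e \<in> B \<Longrightarrow> inner (gale_column k e) y \<le> 0"
      and ge: "\<And>e. e \<in> B' \<Longrightarrow> inner (gale_column k e) y \<ge> 0"
    have meets: "\<exists>j\<in>B. j \<in> X" if X: "crossing_within k X" and B: "B \<in> ?\<B>" for B X
    proof -
      obtain K where K: "is_crossing (2 * k + 4) (k + 1) K" "diagonal_column k ` K \<subseteq> X"
        using X by (auto simp: crossing_within_def)
      obtain j where j: "j \<in> B" "column_diagonal k j \<in> K" using crossing_meets_longest_subword[OF k K(1) B] by blast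
      have "j < 3 * k + 6" using j B by (auto simp: longest_subwords_def)
      then have "j \<in> X" using bij_diagonal_column(3)[OF k, of j] j K(2) by force
      then show ?thesis using j by blast
    qed
    show "y = 0"
    proof (rule ccontr)
      assume "y \<noteq> 0"
      from gale_sign_crossing[OF k this] show False
        using meets[OF _ B(1)] meets[OF _ B(2)] le ge by (metis mem_Collect_eq not_le)
    qed
  qed simp
  then show ?thesis by (simp only: lessThan_iff Ball_def)
qed

section \<open>Linear relations between the columns of \<open>M213 (k + 2)\<close>\<close>

lemma relation_iff_gale:
  fixes c :: "nat \<Rightarrow> real"
  assumes k: "k \<ge> 1" and i: "i < 3 * k"
  shows "(\<Sum>j<3 * k + 6. c j * M213 (k + 2) $$ (i, j)) =
    inner (gale_column k i) (c (3 * k), c (3 * k + 1), c (3 * k + 2), c (3 * k + 3), c (3 * k + 4), c (3 * k + 5)) - c i"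
proof -
  have M: "M213 (k + 2) $$ (i, j) =
      (if j < 3 * k then if i = j then - 1 else 0 else B213 (real (k - i div 3)) $$ (j - 3 * k, i mod 3))"
    if "j < 3 * k + 6" for j
    using M213_entry[of "k + 2" i j] i k that by simp
  have "i div 3 \<le> k" using i by simp
  then have r: "real (k - i div 3) = real k - real (i div 3)" by (simp add: of_nat_diff)
  define A where "A = M213 (k + 2)"
  note M = M[folded A_def]
  \<comment> \<open>The first \<open>3 * k\<close> columns form a negative identity matrix, and row
    \<open>i\<close> of the last six is \<open>gale_column k i\<close>.\<close>
  have "{..<3 * k + 6} = {..<3 * k} \<union> {3 * k, 3 * k + 1, 3 * k + 2, 3 * k + 3, 3 * k + 4, 3 * k + 5}" by auto
  then have "(\<Sum>j<3 * k + 6. c j * A $$ (i, j)) =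
      (\<Sum>j<3 * k. c j * A $$ (i, j)) +
      (\<Sum>j\<in>{3 * k, 3 * k + 1, 3 * k + 2, 3 * k + 3, 3 * k + 4, 3 * k + 5}. c j * A $$ (i, j))"
    by (simp only:) (rule sum.union_disjoint, auto)
  also have "(\<Sum>j<3 * k. c j * A $$ (i, j)) = (\<Sum>j<3 * k. if j = i then - c j else 0)"
    by (rule sum.cong) (auto simp: M)
  also have "\<dots> = - c i" using i by simp
  also have "(\<Sum>j\<in>{3 * k, 3 * k + 1, 3 * k + 2, 3 * k + 3, 3 * k + 4, 3 * k + 5}. c j * A $$ (i, j)) =
      inner (gale_column k i) (c (3 * k), c (3 * k + 1), c (3 * k + 2), c (3 * k + 3), c (3 * k + 4), c (3 * k + 5))"
    by (simp add: M gale_column_def gale_def r mult.commute)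
  finally show ?thesis by (simp add: A_def)
qed

lemma gale_column_last:
  "gale_column k (3 * k) = (1, 0, 0, 0, 0, 0)" "gale_column k (3 * k + 1) = (0, 1, 0, 0, 0, 0)"
  "gale_column k (3 * k + 2) = (0, 0, 1, 0, 0, 0)" "gale_column k (3 * k + 3) = (0, 0, 0, 1, 0, 0)"
  "gale_column k (3 * k + 4) = (0, 0, 0, 0, 1, 0)" "gale_column k (3 * k + 5) = (0, 0, 0, 0, 0, 1)"
proof -
  have d: "(3 * k + 1) div 3 = k" "(3 * k + 1) mod 3 = 1" "(3 * k + 2) div 3 = k" "(3 * k + 2) mod 3 = 2"
    "(3 * k + 3) div 3 = k + 1" "(3 * k + 3) mod 3 = 0" "(3 * k + 4) div 3 = k + 1" "(3 * k + 4) mod 3 = 1"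
    "(3 * k + 5) div 3 = k + 1" "(3 * k + 5) mod 3 = 2" "(3 * k) div 3 = k" "(3 * k) mod 3 = 0"
    by presburger+
  show "gale_column k (3 * k) = (1, 0, 0, 0, 0, 0)" "gale_column k (3 * k + 1) = (0, 1, 0, 0, 0, 0)"
  "gale_column k (3 * k + 2) = (0, 0, 1, 0, 0, 0)" "gale_column k (3 * k + 3) = (0, 0, 0, 1, 0, 0)"
  "gale_column k (3 * k + 4) = (0, 0, 0, 0, 1, 0)" "gale_column k (3 * k + 5) = (0, 0, 0, 0, 0, 1)"
    unfolding gale_column_def d gale_simps by simp_all
qed

text \<open>The last six coefficients determine a relation and serve as the coordinates of
  \<open>y\<close>, because the last six values of \<open>gale_column\<close> are the unit
  vectors.\<close>

lemma relation_imp_gale: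
  fixes c :: "nat \<Rightarrow> real"
  assumes k: "k \<ge> 1" and rel: "\<And>i. i < 3 * k \<Longrightarrow> (\<Sum>j<3 * k + 6. c j * M213 (k + 2) $$ (i, j)) = 0"
  obtains y where "\<And>j. j < 3 * k + 6 \<Longrightarrow> c j = inner (gale_column k j) y"
proof -
  define y where "y = (c (3 * k), c (3 * k + 1), c (3 * k + 2), c (3 * k + 3), c (3 * k + 4), c (3 * k + 5))"
  have "c j = inner (gale_column k j) y" if j: "j < 3 * k + 6" for j
  proof (cases "j < 3 * k")
    case True
    then show ?thesis using relation_iff_gale[OF k True, of c] rel by (simp add: y_def)
  next
    case False
    then consider "j = 3 * k" | "j = 3 * k + 1" | "j = 3 * k + 2" | "j = 3 * k + 3" | "j = 3 * k + 4" | "j = 3 * k + 5"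
      using j by linarith
    then show ?thesis
      by cases (simp_all only: gale_column_last y_def inner_Pair inner_real_def mult_1 mult_zero_left add_0 add_0_right)
  qed
  then show thesis by (rule that)
qed

lemma gale_imp_relation:
  assumes k: "k \<ge> 1" and i: "i < 3 * k"
  shows "(\<Sum>j<3 * k + 6. inner (gale_column k j) y * M213 (k + 2) $$ (i, j)) = 0"
proof -
  obtain y1 y2 y3 y4 y5 y6 where y: "y = (y1, y2, y3, y4, y5, y6)" by (cases y) auto
  have "(inner (gale_column k (3 * k)) y, inner (gale_column k (3 * k + 1)) y, inner (gale_column k (3 * k + 2)) y,
      inner (gale_column k (3 * k + 3)) y, inner (gale_column k (3 * k + 4)) y, inner (gale_column k (3 * k + 5)) y) = y"
    unfolding gale_column_last y by simp
  then show ?thesis unfolding relation_iff_gale[OF k i] by simp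
qed

text \<open>A nonzero relation would be strictly one-signed on a crossing, which would then lie in
  \<open>I\<close> or in \<open>J\<close>. Taking \<open>I = J\<close> gives independence; a
  difference of two conic combinations gives the intersection property.\<close>

lemma faces_relation_zero:
  fixes c :: "nat \<Rightarrow> real"
  assumes k: "k \<ge> 1" and IJ: "I \<in> multi_associahedron (2 * k + 4) k" "J \<in> multi_associahedron (2 * k + 4) k"
    and rel: "\<And>i. i < 3 * k \<Longrightarrow> (\<Sum>j<3 * k + 6. c j * M213 (k + 2) $$ (i, j)) = 0"
    and pos: "\<And>d. d \<in> relevant_diagonals (2 * k + 4) k \<Longrightarrow> c (diagonal_column k d) > 0 \<Longrightarrow> d \<in> I"
    and neg: "\<And>d. d \<in> relevant_diagonals (2 * k + 4) k \<Longrightarrow> c (diagonal_column k d) < 0 \<Longrightarrow> d \<in> J"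
    and j: "j < 3 * k + 6"
  shows "c j = 0"
proof -
  obtain y where y: "\<And>j. j < 3 * k + 6 \<Longrightarrow> c j = inner (gale_column k j) y"
    using relation_imp_gale[OF k rel] by blast
  have "y = 0"
  proof (rule ccontr)
    assume "y \<noteq> 0"
    then obtain K where K: "is_crossing (2 * k + 4) (k + 1) K"
      and sign: "(\<forall>d\<in>K. inner (gale_column k (diagonal_column k d)) y > 0) \<or>
        (\<forall>d\<in>K. inner (gale_column k (diagonal_column k d)) y < 0)"
      using gale_sign_crossing[OF k \<open>y \<noteq> 0\<close>] unfolding crossing_within_def by blast
    have rel: "d \<in> relevant_diagonals (2 * k + 4) k" if "d \<in> K" for d
      using K that unfolding relevant_diagonals_def by blast
    then have cd: "c (diagonal_column k d) = inner (gale_column k (diagonal_column k d)) y" if "d \<in> K" for d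
      using rel[OF that] bij_betwE[OF bij_diagonal_column(1)[OF k]] by (intro y) blast
    have "K \<subseteq> I \<or> K \<subseteq> J" using sign rel cd pos neg by (metis subsetI)
    then show False using IJ K unfolding multi_associahedron_def by blast
  qed
  then show ?thesis using y[OF j] by simp
qed

text \<open>Coefficients on a face are extended by zero to all columns, the form required by
  \<open>faces_relation_zero\<close>.\<close>

lemma sum_face_columns:
  fixes c :: "nat \<times> nat \<Rightarrow> real"
  assumes k: "k \<ge> 1" and I: "I \<subseteq> relevant_diagonals (2 * k + 4) k"
  shows "(\<Sum>d\<in>I. c d * M213 (k + 2) $$ (i, diagonal_column k d)) =
    (\<Sum>j<3 * k + 6. (if column_diagonal k j \<in> I then c (column_diagonal k j) else 0) * M213 (k + 2) $$ (i, j))"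
proof -
  let ?R = "relevant_diagonals (2 * k + 4) k"
  note bij = bij_diagonal_column[OF k]
  note inv = bij(4)
  have "(\<Sum>j<3 * k + 6. (if column_diagonal k j \<in> I then c (column_diagonal k j) else 0) * M213 (k + 2) $$ (i, j)) =
      (\<Sum>d\<in>?R. (if d \<in> I then c d else 0) * M213 (k + 2) $$ (i, diagonal_column k d))"
    by (subst sum.reindex_bij_betw[OF bij(1), symmetric]) (auto intro!: sum.cong simp: inv)
  also have "\<dots> = (\<Sum>d\<in>I. c d * M213 (k + 2) $$ (i, diagonal_column k d))"
    using I by (intro sum.mono_neutral_cong_right finite_relevant) auto
  finally show ?thesis by simp
qed

lemma face_columns_independent:
  fixes c :: "nat \<times> nat \<Rightarrow> real"
  assumes k: "k \<ge> 1" and I: "I \<in> multi_associahedron (2 * k + 4) k" and "I0 \<subseteq> I"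
    and rel: "\<And>i. i < 3 * k \<Longrightarrow> (\<Sum>d\<in>I0. c d * M213 (k + 2) $$ (i, diagonal_column k d)) = 0"
    and d: "d \<in> I0"
  shows "c d = 0"
proof -
  note bij = bij_diagonal_column[OF k]
  let ?c = "\<lambda>j. if column_diagonal k j \<in> I0 then c (column_diagonal k j) else 0"
  have IR: "I0 \<subseteq> relevant_diagonals (2 * k + 4) k"
    using I \<open>I0 \<subseteq> I\<close> by (auto simp: multi_associahedron_def)
  note inv = bij(4)
  have "?c (diagonal_column k d) = 0"
  proof (rule faces_relation_zero[OF k I I])
    show "(\<Sum>j<3 * k + 6. ?c j * M213 (k + 2) $$ (i, j)) = 0" if "i < 3 * k" for i
      using rel[OF that] sum_face_columns[OF k IR, of c i] by simp
    show "diagonal_column k d < 3 * k + 6" using bij_betwE[OF bij(1)] IR d by blast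
  qed (use inv \<open>I0 \<subseteq> I\<close> in \<open>auto split: if_splits\<close>)
  moreover have "column_diagonal k (diagonal_column k d) = d" using inv IR d by blast
  ultimately show ?thesis using d by simp
qed

theorem corollary2p11:
  fixes k :: nat
  assumes "k \<ge> 1"
  shows "complete_simplicial_fan_realization (3 * k)
    (\<lambda>d. col (M213 (k + 2)) (diagonal_column k d))
    (multi_associahedron (2 * k + 4) k)"
proof -
  define n where "n = 3 * k"
  define R where "R = relevant_diagonals (2 * k + 4) k"
  define \<Delta> where "\<Delta> = multi_associahedron (2 * k + 4) k"
  define A where "A = M213 (k + 2)"
  define v where "v d = col A (diagonal_column k d)" for d
  note k = \<open>k \<ge> 1\<close>
  note bij = bij_diagonal_column[OF k, folded R_def]
  have A: "A \<in> carrier_mat n (3 * k + 6)" using dim_M213[of "k + 2"] k by (simp add: A_def n_def add.commute)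
  have sub: "I \<subseteq> R" "finite I" if "I \<in> \<Delta>" for I
    using that finite_relevant finite_subset by (auto simp: \<Delta>_def R_def multi_associahedron_def)
  note inv = bij(4)
  have lt: "diagonal_column k d < 3 * k + 6" if "d \<in> R" for d using bij_betwE[OF bij(1)] that by blast
  have v: "v d \<in> carrier_vec n" for d using A by (intro carrier_vecI) (simp add: v_def)
  have vi: "v d $ i = A $$ (i, diagonal_column k d)" if "i < n" "d \<in> R" for d i
    using A that lt by (simp add: v_def)
  define w where "w c I = finsum_vec TYPE(real) n (\<lambda>d. c d \<cdot>\<^sub>v v d) I" for c I
  have w: "w c I \<in> carrier_vec n" for c I
    unfolding w_def using v by (intro finsum_vec_closed) auto
  have wi: "w c I $ i = (\<Sum>d\<in>I. c d * A $$ (i, diagonal_column k d))" if "i < n" "I \<subseteq> R" "finite I" for c I i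
  proof -
    have "w c I $ i = (\<Sum>d\<in>I. (c d \<cdot>\<^sub>v v d) $ i)"
      unfolding w_def using that v by (subst index_finsum_vec) auto
    also have "\<dots> = (\<Sum>d\<in>I. c d * A $$ (i, diagonal_column k d))"
      using that v vi by (intro sum.cong refl) (metis carrier_vecD index_smult_vec(1) subsetD)
    finally show ?thesis .
  qed
  have cone: "spanned_cone n v I = {w c I | c. \<forall>d\<in>I. c d \<ge> 0}" for I
    by (simp add: spanned_cone_def w_def)
  note indep = face_columns_independent[OF k, folded \<Delta>_def A_def n_def]

  have independent: "v ` I \<subseteq> carrier_vec n \<and> inj_on v I \<and>
      \<not> module.lin_dep class_ring (module_vec TYPE(real) n) (v ` I)" if I: "I \<in> \<Delta>" for I
  proof (intro conjI)
    show "v ` I \<subseteq> carrier_vec n" using v by blast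
    show inj: "inj_on v I"
    proof (rule inj_onI, rule ccontr)
      fix d e assume de: "d \<in> I" "e \<in> I" "v d = v e" "d \<noteq> e"
      let ?c = "\<lambda>x. if x = d then 1 else - 1 :: real"
      have "?c d = 0"
      proof (rule indep[OF I, of "{d, e}" ?c])
        fix i assume "i < n"
        have "d \<in> R" "e \<in> R" using de sub(1)[OF I] by blast+
        from vi[OF \<open>i < n\<close> this(1)] vi[OF \<open>i < n\<close> this(2)]
        have "A $$ (i, diagonal_column k d) = A $$ (i, diagonal_column k e)" using de(3) by simp
        then show "(\<Sum>x\<in>{d, e}. ?c x * A $$ (i, diagonal_column k x)) = 0" using de by simp
      qed (use de in auto)
      then show False by simp
    qed
    interpret vec_space "TYPE(real)" n .
    show "\<not> lin_dep (v ` I)"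
    proof
      assume "lin_dep (v ` I)"
      then obtain S a u where S: "finite S" "S \<subseteq> v ` I" "lincomb a S = \<zero>\<^bsub>V\<^esub>" "u \<in> S" "a u \<noteq> 0"
        unfolding lin_dep_def by auto
      then obtain I0 where I0: "I0 \<subseteq> I" "S = v ` I0" by (meson subset_imageE)
      then obtain d where d: "d \<in> I0" "u = v d" using S(4) by blast
      have "a (v d) = 0"
      proof (rule indep[OF I I0(1) _ d(1), where c = "\<lambda>d. a (v d)"])
        fix i assume "i < n"
        have "0 = lincomb a S $ i" using S(3) \<open>i < n\<close> by simp
        also have "\<dots> = (\<Sum>u\<in>S. a u * u $ i)"
          using S(2) v \<open>i < n\<close> by (intro lincomb_index) auto
        also have "\<dots> = (\<Sum>d\<in>I0. a (v d) * v d $ i)"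
          unfolding I0(2) using inj I0(1) by (subst sum.reindex) (auto intro: inj_on_subset)
        also have "\<dots> = (\<Sum>d\<in>I0. a (v d) * A $$ (i, diagonal_column k d))"
          using vi[OF \<open>i < n\<close>] I0(1) sub(1)[OF I] by (intro sum.cong refl) auto
        finally show "(\<Sum>d\<in>I0. a (v d) * A $$ (i, diagonal_column k d)) = 0" by simp
      qed
      then show False using d S(5) by simp
    qed
  qed

  have intersection: "spanned_cone n v I \<inter> spanned_cone n v J = spanned_cone n v (I \<inter> J)"
    if IJ: "I \<in> \<Delta>" "J \<in> \<Delta>" for I J
  proof (intro equalityI subsetI)
    have inter: "I \<inter> J \<subseteq> R" "finite (I \<inter> J)" using sub[OF IJ(1)] by auto
    have ext: "w c (I \<inter> J) = w (\<lambda>d. if d \<in> I \<inter> J then c d else 0) X" if "X = I \<or> X = J" for c X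
    proof (rule eq_vecI)
      have X: "X \<subseteq> R" "finite X" "I \<inter> J \<subseteq> X" using that IJ sub by auto
      fix i assume "i < dim_vec (w (\<lambda>d. if d \<in> I \<inter> J then c d else 0) X)"
      then have "i < n" using w by (metis carrier_vecD)
      show "w c (I \<inter> J) $ i = w (\<lambda>d. if d \<in> I \<inter> J then c d else 0) X $ i"
        unfolding wi[OF \<open>i < n\<close> inter] wi[OF \<open>i < n\<close> X(1,2)]
        using X by (intro sum.mono_neutral_cong_left) auto
    qed (use w in \<open>metis carrier_vecD\<close>)
    fix x
    {
      assume "x \<in> spanned_cone n v (I \<inter> J)"
      then obtain c where c: "x = w c (I \<inter> J)" "\<forall>d\<in>I \<inter> J. c d \<ge> 0" unfolding cone by blast
      then show "x \<in> spanned_cone n v I \<inter> spanned_cone n v J"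
        using ext[of I c] ext[of J c] unfolding cone by fastforce
    next
      assume "x \<in> spanned_cone n v I \<inter> spanned_cone n v J"
      then obtain a b where a: "x = w a I" "\<forall>d\<in>I. a d \<ge> 0" and b: "x = w b J" "\<forall>d\<in>J. b d \<ge> 0"
        unfolding cone by blast
      let ?a = "\<lambda>j. if column_diagonal k j \<in> I then a (column_diagonal k j) else 0"
      let ?b = "\<lambda>j. if column_diagonal k j \<in> J then b (column_diagonal k j) else 0"
      \<comment> \<open>Two conic representations of \<open>x\<close> differ by a relation that is
        positive only on \<open>I\<close> and negative only on \<open>J\<close>. So they agree on
        every column and vanish off \<open>I \<inter> J\<close>.\<close>
      have eq: "?a j = ?b j" if "j < 3 * k + 6" for j
      proof -
        have "?a j - ?b j = 0"
        proof (rule faces_relation_zero[where c = "\<lambda>j. ?a j - ?b j", OF k, folded \<Delta>_def R_def A_def])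
          show "(\<Sum>j<3 * k + 6. (?a j - ?b j) * A $$ (i, j)) = 0" if "i < 3 * k" for i
          proof -
            have "i < n" using that by (simp add: n_def)
            have "w a I $ i = w b J $ i" using a b by simp
            then show ?thesis
              using wi[OF \<open>i < n\<close> sub[OF IJ(1)], of a] wi[OF \<open>i < n\<close> sub[OF IJ(2)], of b]
                sum_face_columns[OF k, folded R_def A_def, OF sub(1)[OF IJ(1)], of a i]
                sum_face_columns[OF k, folded R_def A_def, OF sub(1)[OF IJ(2)], of b i]
              by (simp add: left_diff_distrib sum_subtractf)
          qed
          fix d assume "d \<in> R"
          then show "?a (diagonal_column k d) - ?b (diagonal_column k d) > 0 \<Longrightarrow> d \<in> I"
            "?a (diagonal_column k d) - ?b (diagonal_column k d) < 0 \<Longrightarrow> d \<in> J"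
            using a(2) b(2) by (auto simp: inv split: if_splits)
        qed (use IJ that in auto)
        then show ?thesis by simp
      qed
      have zero: "a d = 0" if "d \<in> I - J" for d
      proof -
        have "d \<in> R" using that sub(1)[OF IJ(1)] by blast
        from eq[OF lt[OF this]] inv[OF this] show ?thesis using that by simp
      qed
      have "w a I = w a (I \<inter> J)"
      proof (rule eq_vecI)
        fix i assume "i < dim_vec (w a (I \<inter> J))"
        then have "i < n" using w by (metis carrier_vecD)
        then show "w a I $ i = w a (I \<inter> J) $ i"
          unfolding wi[OF \<open>i < n\<close> inter] wi[OF \<open>i < n\<close> sub[OF IJ(1)]]
          using sub[OF IJ(1)] zero by (intro sum.mono_neutral_right) auto
      qed (use w in \<open>metis carrier_vecD\<close>)
      then show "x \<in> spanned_cone n v (I \<inter> J)" using a unfolding cone by blast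
    }
  qed

  have complete: "(\<Union>I\<in>\<Delta>. spanned_cone n v I) = carrier_vec n"
  proof (intro equalityI subsetI)
    fix x assume "x \<in> (\<Union>I\<in>\<Delta>. spanned_cone n v I)"
    then show "x \<in> carrier_vec n" using w unfolding cone by blast
  next
    fix x :: "real vec" assume x: "x \<in> carrier_vec n"
    \<comment> \<open>As the first \<open>n\<close> columns form a negative identity matrix,
      \<open>c0\<close> represents \<open>x\<close>. Adding a relation keeps this and makes all
      coefficients nonnegative, with zeros on \<open>B\<close>.\<close>
    define c0 where "c0 j = (if j < n then - x $ j else 0)" for j
    obtain y B where B: "B \<in> longest_subwords (3 * k + 6)"
      and ge: "\<And>j. j < 3 * k + 6 \<Longrightarrow> c0 j + inner (gale_column k j) y \<ge> 0"
      and zero: "\<And>j. j \<in> B \<Longrightarrow> c0 j + inner (gale_column k j) y = 0"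
      using gale_dual_complete[OF k, of c0] by blast
    define c where "c j = c0 j + inner (gale_column k j) y" for j
    \<comment> \<open>The complement of \<open>B\<close> is a face because every crossing meets
      \<open>B\<close>, and it carries all nonzero coefficients of \<open>c\<close>.\<close>
    define I where "I = {d \<in> R. diagonal_column k d \<notin> B}"
    have "I \<in> \<Delta>"
    proof -
      have False if K: "K \<subseteq> I" "is_crossing (2 * k + 4) (k + 1) K" for K
      proof -
        obtain j where j: "j \<in> B" "column_diagonal k j \<in> K" using crossing_meets_longest_subword[OF k K(2) B] by blast
        then have "j < 3 * k + 6" using B by (auto simp: longest_subwords_def)
        then show False using bij(3)[of j] j K(1) by (auto simp: I_def)
      qed
      then show ?thesis unfolding \<Delta>_def multi_associahedron_def by (auto simp: I_def R_def)
    qed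
    have "x = w (\<lambda>d. c (diagonal_column k d)) I"
    proof (rule eq_vecI)
      fix i assume "i < dim_vec (w (\<lambda>d. c (diagonal_column k d)) I)"
      then have i: "i < n" using w by (metis carrier_vecD)
      have c_ext: "(if column_diagonal k j \<in> I then c (diagonal_column k (column_diagonal k j)) else 0) = c j"
        if "j < 3 * k + 6" for j
        using bij(2,3)[OF that] zero[of j] by (auto simp: I_def c_def)
      have "w (\<lambda>d. c (diagonal_column k d)) I $ i = (\<Sum>j<3 * k + 6. c j * A $$ (i, j))"
        using wi[OF i sub[OF \<open>I \<in> \<Delta>\<close>]] sum_face_columns[OF k, folded R_def A_def, OF sub(1)[OF \<open>I \<in> \<Delta>\<close>]]
        by (simp add: c_ext)
      also have "\<dots> = (\<Sum>j<3 * k + 6. c0 j * A $$ (i, j)) +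
          (\<Sum>j<3 * k + 6. inner (gale_column k j) y * A $$ (i, j))"
        by (simp add: c_def distrib_right sum.distrib)
      also have "(\<Sum>j<3 * k + 6. inner (gale_column k j) y * A $$ (i, j)) = 0"
        using gale_imp_relation[OF k, of i y] i by (simp add: A_def n_def)
      also have "(\<Sum>j<3 * k + 6. c0 j * A $$ (i, j)) = x $ i"
        using relation_iff_gale[OF k, of i c0] i by (simp add: A_def n_def c0_def inner_Pair zero_prod_def[symmetric])
      finally show "x $ i = w (\<lambda>d. c (diagonal_column k d)) I $ i" by simp
    qed (use w x in \<open>metis carrier_vecD\<close>)
    moreover have "\<forall>d\<in>I. c (diagonal_column k d) \<ge> 0" using ge lt by (auto simp: c_def I_def)
    ultimately show "x \<in> (\<Union>I\<in>\<Delta>. spanned_cone n v I)" using \<open>I \<in> \<Delta>\<close> unfolding cone by blast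
  qed
  show ?thesis
    using independent intersection complete
    unfolding complete_simplicial_fan_realization_def \<Delta>_def[symmetric] A_def[symmetric] n_def[symmetric]
      v_def[abs_def, symmetric] by blast
qed

end
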